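(* Suppose $\omega$ satisfies $\lim_{t\to0^+}\frac{t}{\omega(t)}=0$. Then the space of $C^\infty$ functions with compact supports on $\mathbb R^n$ is dense in $C_0^{k,\omega}(\mathbb R^n)$. In particular, for every closed $S\subset\mathbb R^n$ the space $C_0^{k,\omega}(S)$ is separable.
   Context: Let $n\in\mathbb N$, $k\in\mathbb Z_+$, and let $\omega:(0,\infty)\to(0,\infty)$ be a modulus of continuity, meaning that (i) $\omega(t)$ and $t/\omega(t)$ are nondecreasing on $(0,\infty)$, and (ii) $\lim_{t\to0^+}\omega(t)=0$. All functions are real-valued and $\|\cdot\|$ on $\mathbb R^n$ is the Euclidean norm. $C_b^{k,\omega}(\mathbb R^n)$ is the Banach space of $f\in C^k(\mathbb R^n)$ with finite norm $\|f\|_{C_b^{k,\omega}(\mathbb R^n)}:=\max\bigl(\|f\|_{C_b^k(\mathbb R^n)},|f|_{C_b^{k,\omega}(\mathbb R^n)}\bigr)$, where $\|f\|_{C_b^k(\mathbb R^n)}:=\max_{|\alpha|\le k}\sup_{x}|D^\alpha f(x)|$ and $|f|_{C_b^{k,\omega}(\mathbb R^n)}:=\max_{|\alpha|=k}\sup_{x\neq y}\frac{|D^\alpha f(x)-D^\alpha f(y)|}{\omega(\|x-y\|)}$. $C_0^{k,\omega}(\mathbb R^n)$ is the closed subspace (with the induced norm) of $f\in C_b^{k,\omega}(\mathbb R^n)$ such that $\lim_{\|x\|\to\infty}D^\alpha f(x)=0$ for all $|\alpha|\le k$, and $\lim_{\|x-y\|\to0}\frac{D^\alpha f(x)-D^\alpha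 f(y)}{\omega(\|x-y\|)}=0$ (uniformly in $x\ne y$ as $\|x-y\|\to0$) for all $|\alpha|=k$. $C_0^{k,\omega}(S)$ is the space of restrictions to $S$ of functions in $C_0^{k,\omega}(\mathbb R^n)$, with the trace (quotient) norm given by the infimum of norms of extensions in $C_0^{k,\omega}(\mathbb R^n)$. *)

theory Defs
  imports "HOL-Analysis.Analysis"
begin

definition modulus_of_continuity :: "(real \<Rightarrow> real) \<Rightarrow> bool" where
  "modulus_of_continuity \<omega> \<longleftrightarrow>
     (\<forall>t>0. 0 < \<omega> t) \<and>
     mono_on {0<..} \<omega> \<and>
     mono_on {0<..} (\<lambda>t. t / \<omega> t) \<and>
     (\<omega> \<longlongrightarrow> 0) (at_right 0)"

definition pderiv_at :: "'n::finite \<Rightarrow> (real^'n \<Rightarrow> real) \<Rightarrow> real^'n \<Rightarrow> real" where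
  "pderiv_at i f x = deriv (\<lambda>t. f (x + t *\<^sub>R axis i 1)) 0"

fun pderivs :: "'n::finite list \<Rightarrow> (real^'n \<Rightarrow> real) \<Rightarrow> real^'n \<Rightarrow> real" where
  "pderivs [] f = f"
| "pderivs (i # is) f = pderiv_at i (pderivs is f)"

text \<open>All iterated partial derivatives of order at most \<open>k\<close>, in every order of differentiation,
  exist and are continuous.\<close>

definition C_k :: "nat \<Rightarrow> (real^'n::finite \<Rightarrow> real) \<Rightarrow> bool" where
  "C_k k f \<longleftrightarrow>
     (\<forall>is. length is \<le> k \<longrightarrow> continuous_on UNIV (pderivs is f)) \<and>
     (\<forall>is i x. length is < k \<longrightarrow>
        (\<lambda>t. pderivs is f (x + t *\<^sub>R axis i 1)) differentiable (at 0))"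

text \<open>A multi-index is a function \<open>\<alpha> :: 'n \<Rightarrow> nat\<close>. The index type carries no order, so one
  enumeration \<open>i\<^sub>1, \<dots>, i\<^sub>n\<close> of it is fixed once and for all, and \<open>mderiv \<alpha>\<close>
  differentiates \<open>\<alpha> i\<^sub>n\<close> times in direction \<open>i\<^sub>n\<close>, ..., and finally \<open>\<alpha> i\<^sub>1\<close> times in direction \<open>i\<^sub>1\<close>.
  For functions of class \<open>C\<^sup>k\<close> and \<open>|\<alpha>| \<le> k\<close> the choice of the enumeration is immaterial (symmetry of mixed partial derivatives).\<close>

definition coords :: "'n::finite list" where
  "coords = (SOME is. distinct is \<and> set is = UNIV)"

definition mi_order :: "('n::finite \<Rightarrow> nat) \<Rightarrow> nat" where
  "mi_order \<alpha> = (\<Sum>i\<in>UNIV. \<alpha> i)"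

definition mderiv :: "('n::finite \<Rightarrow> nat) \<Rightarrow> (real^'n \<Rightarrow> real) \<Rightarrow> real^'n \<Rightarrow> real" where
  "mderiv \<alpha> = pderivs (concat (map (\<lambda>i. replicate (\<alpha> i) i) coords))"

definition Ck_enorm :: "nat \<Rightarrow> (real^'n::finite \<Rightarrow> real) \<Rightarrow> ennreal" where
  "Ck_enorm k f = (SUP \<alpha>\<in>{\<alpha>. mi_order \<alpha> \<le> k}. SUP x. ennreal \<bar>mderiv \<alpha> f x\<bar>)"

definition Ck_eseminorm :: "nat \<Rightarrow> (real \<Rightarrow> real) \<Rightarrow> (real^'n::finite \<Rightarrow> real) \<Rightarrow> ennreal" where
  "Ck_eseminorm k \<omega> f =
     (SUP \<alpha>\<in>{\<alpha>. mi_order \<alpha> = k}. SUP x. SUP y\<in>-{x}.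
        ennreal (\<bar>mderiv \<alpha> f x - mderiv \<alpha> f y\<bar> / \<omega> (norm (x - y))))"

text \<open>The norm of \<open>C\<^sub>b\<^sup>k\<^sup>,\<^sup>\<omega>\<close> as an extended quantity; it is infinite outside \<open>C\<^sup>k\<close>, where \<open>mderiv \<alpha> f\<close>
  is a junk value.\<close>

definition Cb_enorm :: "nat \<Rightarrow> (real \<Rightarrow> real) \<Rightarrow> (real^'n::finite \<Rightarrow> real) \<Rightarrow> ennreal" where
  "Cb_enorm k \<omega> f = (if C_k k f then max (Ck_enorm k f) (Ck_eseminorm k \<omega> f) else \<infinity>)"

definition Cb_norm :: "nat \<Rightarrow> (real \<Rightarrow> real) \<Rightarrow> (real^'n::finite \<Rightarrow> real) \<Rightarrow> real" where
  "Cb_norm k \<omega> f = enn2real (Cb_enorm k \<omega> f)"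

definition Cb_space :: "nat \<Rightarrow> (real \<Rightarrow> real) \<Rightarrow> (real^'n::finite \<Rightarrow> real) set" where
  "Cb_space k \<omega> = {f. C_k k f \<and> Cb_enorm k \<omega> f < \<infinity>}"

definition C0_space :: "nat \<Rightarrow> (real \<Rightarrow> real) \<Rightarrow> (real^'n::finite \<Rightarrow> real) set" where
  "C0_space k \<omega> = {f \<in> Cb_space k \<omega>.
     (\<forall>\<alpha>. mi_order \<alpha> \<le> k \<longrightarrow> (mderiv \<alpha> f \<longlongrightarrow> 0) at_infinity) \<and>
     (\<forall>\<alpha>. mi_order \<alpha> = k \<longrightarrow>
        (\<forall>\<epsilon>>0. \<exists>\<delta>>0. \<forall>x y. x \<noteq> y \<and> norm (x - y) < \<delta> \<longrightarrow>
           \<bar>(mderiv \<alpha> f x - mderiv \<alpha> f y) / \<omega> (norm (x - y))\<bar> < \<epsilon>))}"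

definition C0_topology :: "nat \<Rightarrow> (real \<Rightarrow> real) \<Rightarrow> (real^'n::finite \<Rightarrow> real) topology" where
  "C0_topology k \<omega> =
     Metric_space.mtopology (C0_space k \<omega>) (\<lambda>f g. Cb_norm k \<omega> (\<lambda>x. f x - g x))"

definition Cc_infty :: "(real^'n::finite \<Rightarrow> real) set" where
  "Cc_infty = {f. (\<forall>m. C_k m f) \<and> compact (closure {x. f x \<noteq> 0})}"

text \<open>Functions on \<open>S\<close> are represented by functions that are \<open>undefined\<close> outside \<open>S\<close>.\<close>

definition C0_trace ::
  "nat \<Rightarrow> (real \<Rightarrow> real) \<Rightarrow> (real^'n::finite) set \<Rightarrow> (real^'n \<Rightarrow> real) set" where
  "C0_trace k \<omega> S = (\<lambda>F. restrict F S) ` C0_space k \<omega>"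

text \<open>Only the values of the argument on \<open>S\<close> matter.\<close>

definition trace_norm ::
  "nat \<Rightarrow> (real \<Rightarrow> real) \<Rightarrow> (real^'n::finite) set \<Rightarrow> (real^'n \<Rightarrow> real) \<Rightarrow> real" where
  "trace_norm k \<omega> S h =
     enn2real (INF F\<in>{F \<in> C0_space k \<omega>. \<forall>x\<in>S. F x = h x}. Cb_enorm k \<omega> F)"

definition C0_trace_topology ::
  "nat \<Rightarrow> (real \<Rightarrow> real) \<Rightarrow> (real^'n::finite) set \<Rightarrow> (real^'n \<Rightarrow> real) topology" where
  "C0_trace_topology k \<omega> S =
     Metric_space.mtopology (C0_trace k \<omega> S) (\<lambda>g h. trace_norm k \<omega> S (\<lambda>x. g x - h x))"

text \<open>The two distance functions are metrics, so that the topologies above are the norm topologies.\<close>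

lemma length_mi_word: "length (concat (map (\<lambda>i. replicate (\<alpha> i) i) coords)) = mi_order \<alpha>"
proof -
  have *: "distinct (coords :: 'a list) \<and> set (coords :: 'a list) = UNIV"
    unfolding coords_def
  proof (rule someI_ex)
    show "\<exists>is :: 'a list. distinct is \<and> set is = UNIV"
      using finite_distinct_list[OF finite_class.finite_UNIV] by blast
  qed
  have "length (concat (map (\<lambda>i. replicate (\<alpha> i) i) coords)) = sum_list (map \<alpha> coords)"
    by (simp add: length_concat o_def)
  also have "\<dots> = sum \<alpha> (set coords)"
    using * by (intro sum_list_distinct_conv_sum_set) blast
  finally show ?thesis by (simp only: * mi_order_def)
qed

lemma pderivs_diff:
  assumes "C_k k f" "C_k k g" "length is \<le> k"
  shows "pderivs is (\<lambda>x. f x - g x) = (\<lambda>x. pderivs is f x - pderivs is g x)"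
  using assms(3)
proof (induction "is")
  case (Cons i "is")
  then have "length is < k" by simp
  with assms(1,2) have "(\<lambda>t. pderivs is f (x + t *\<^sub>R axis i 1)) field_differentiable at 0"
      "(\<lambda>t. pderivs is g (x + t *\<^sub>R axis i 1)) field_differentiable at 0" for x
    unfolding C_k_def field_differentiable_def real_differentiable_def by auto
  with Cons show ?case by (auto simp: pderiv_at_def fun_eq_iff)
qed auto

lemma C_k_diff:
  assumes "C_k k f" "C_k k g"
  shows "C_k k (\<lambda>x. f x - g x)"
  unfolding C_k_def
proof (intro conjI allI impI)
  fix "is" :: "'a list" assume "length is \<le> k"
  then show "continuous_on UNIV (pderivs is (\<lambda>x. f x - g x))"
    using assms unfolding pderivs_diff[OF assms \<open>length is \<le> k\<close>] C_k_def
    by (intro continuous_on_diff) blast+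
next
  fix "is" :: "'a list" and i :: 'a and x :: "real^'a" assume l: "length is < k"
  show "(\<lambda>t. pderivs is (\<lambda>x. f x - g x) (x + t *\<^sub>R axis i 1)) differentiable at 0"
    using assms l unfolding pderivs_diff[OF assms less_imp_le[OF l]] C_k_def
    by (intro differentiable_diff) blast+
qed

lemma mderiv_diff:
  assumes "C_k k f" "C_k k g" "mi_order \<alpha> \<le> k"
  shows "mderiv \<alpha> (\<lambda>x. f x - g x) = (\<lambda>x. mderiv \<alpha> f x - mderiv \<alpha> g x)"
  unfolding mderiv_def by (rule pderivs_diff[OF assms(1,2)]) (simp only: length_mi_word assms(3))

lemma Cb_enorm_le_iff:
  assumes "C_k k f"
  shows "Cb_enorm k \<omega> f \<le> c \<longleftrightarrow>
    (\<forall>\<alpha> x. mi_order \<alpha> \<le> k \<longrightarrow> ennreal \<bar>mderiv \<alpha> f x\<bar> \<le> c) \<and>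
    (\<forall>\<alpha> x y. mi_order \<alpha> = k \<longrightarrow> y \<noteq> x \<longrightarrow>
       ennreal (\<bar>mderiv \<alpha> f x - mderiv \<alpha> f y\<bar> / \<omega> (norm (x - y))) \<le> c)"
  unfolding Cb_enorm_def Ck_enorm_def Ck_eseminorm_def if_P[OF assms] max.bounded_iff SUP_le_iff
  by blast

lemma Cb_enorm_diff:
  assumes f: "C_k k f" and g: "C_k k g" and w: "modulus_of_continuity \<omega>"
  shows "Cb_enorm k \<omega> (\<lambda>x. f x - g x) \<le> Cb_enorm k \<omega> f + Cb_enorm k \<omega> g"
proof -
  have le: "ennreal a \<le> Cb_enorm k \<omega> f + Cb_enorm k \<omega> g"
    if "a \<le> b + c" "0 \<le> b" "0 \<le> c" "ennreal b \<le> Cb_enorm k \<omega> f" "ennreal c \<le> Cb_enorm k \<omega> g" for a b c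
  proof -
    have "ennreal a \<le> ennreal b + ennreal c"
      using ennreal_leI[OF that(1)] by (simp only: ennreal_plus[OF that(2,3)])
    also have "\<dots> \<le> Cb_enorm k \<omega> f + Cb_enorm k \<omega> g"
      by (rule add_mono[OF that(4,5)])
    finally show ?thesis .
  qed
  note bound = iffD1[OF Cb_enorm_le_iff order_refl]
  note sup = bound[THEN conjunct1, rule_format] and osc = bound[THEN conjunct2, rule_format]
  show ?thesis
    unfolding Cb_enorm_le_iff[OF C_k_diff[OF f g]]
  proof (intro conjI allI impI)
    fix \<alpha> :: "'a \<Rightarrow> nat" and x :: "real^'a" assume a: "mi_order \<alpha> \<le> k"
    have "\<bar>mderiv \<alpha> (\<lambda>x. f x - g x) x\<bar> \<le> \<bar>mderiv \<alpha> f x\<bar> + \<bar>mderiv \<alpha> g x\<bar>"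
      unfolding mderiv_diff[OF f g a] by (rule abs_triangle_ineq4)
    then show "ennreal \<bar>mderiv \<alpha> (\<lambda>x. f x - g x) x\<bar> \<le> Cb_enorm k \<omega> f + Cb_enorm k \<omega> g"
      by (rule le[OF _ abs_ge_zero abs_ge_zero sup[OF f a] sup[OF g a]])
  next
    fix \<alpha> :: "'a \<Rightarrow> nat" and x y :: "real^'a" assume a: "mi_order \<alpha> = k" "y \<noteq> x"
    let ?w = "\<omega> (norm (x - y))"
    have w0: "0 \<le> ?w" using w a by (simp add: modulus_of_continuity_def less_imp_le)
    have "\<bar>mderiv \<alpha> (\<lambda>x. f x - g x) x - mderiv \<alpha> (\<lambda>x. f x - g x) y\<bar>
        \<le> \<bar>mderiv \<alpha> f x - mderiv \<alpha> f y\<bar> + \<bar>mderiv \<alpha> g x - mderiv \<alpha> g y\<bar>"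
      unfolding mderiv_diff[OF f g eq_refl[OF a(1)]] by linarith
    then have "\<bar>mderiv \<alpha> (\<lambda>x. f x - g x) x - mderiv \<alpha> (\<lambda>x. f x - g x) y\<bar> / ?w
        \<le> \<bar>mderiv \<alpha> f x - mderiv \<alpha> f y\<bar> / ?w + \<bar>mderiv \<alpha> g x - mderiv \<alpha> g y\<bar> / ?w"
      unfolding add_divide_distrib[symmetric] by (rule divide_right_mono[OF _ w0])
    then show "ennreal (\<bar>mderiv \<alpha> (\<lambda>x. f x - g x) x - mderiv \<alpha> (\<lambda>x. f x - g x) y\<bar> / ?w)
        \<le> Cb_enorm k \<omega> f + Cb_enorm k \<omega> g"
      by (rule le[OF _ divide_nonneg_nonneg[OF abs_ge_zero w0] divide_nonneg_nonneg[OF abs_ge_zero w0]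
            osc[OF f a] osc[OF g a]])
  qed
qed

lemma pderivs_zero: "pderivs is (\<lambda>x. 0) = (\<lambda>x. 0)"
  by (induction "is") (auto simp: pderiv_at_def fun_eq_iff)

lemma C_k_zero: "C_k k (\<lambda>x. 0)"
  by (simp add: C_k_def pderivs_zero)

lemma Cb_enorm_zero: "Cb_enorm k \<omega> (\<lambda>x. 0) = 0"
  using Cb_enorm_le_iff[OF C_k_zero, of k \<omega> 0] by (simp add: mderiv_def pderivs_zero)

lemma Cb_enorm_minus:
  assumes w: "modulus_of_continuity \<omega>"
  shows "Cb_enorm k \<omega> (\<lambda>x. g x - f x) = Cb_enorm k \<omega> (\<lambda>x. f x - g x)"
proof -
  have le: "Cb_enorm k \<omega> (\<lambda>x. u x - v x) \<le> Cb_enorm k \<omega> (\<lambda>x. v x - u x)"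
    for u v :: "real^'a \<Rightarrow> real"
  proof (cases "C_k k (\<lambda>x. v x - u x)")
    case True
    show ?thesis
      using Cb_enorm_diff[OF C_k_zero True w] by (simp add: Cb_enorm_zero)
  next
    case False
    then show ?thesis by (simp add: Cb_enorm_def)
  qed
  show ?thesis by (rule antisym[OF le le])
qed

lemma abs_le_Cb_enorm: "ennreal \<bar>f x\<bar> \<le> Cb_enorm k \<omega> f"
proof (cases "C_k k f")
  case True
  have "concat (map (\<lambda>i. replicate 0 i) xs) = []" for xs :: "'a list"
    by (induction xs) auto
  then have 0: "mderiv (\<lambda>_. 0) f = f"
    by (simp only: mderiv_def pderivs.simps)
  have "mi_order (\<lambda>_::'a. 0) \<le> k"
    by (simp add: mi_order_def)
  then have "ennreal \<bar>mderiv (\<lambda>_. 0) f x\<bar> \<le> Cb_enorm k \<omega> f"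
    by (rule iffD1[OF Cb_enorm_le_iff[OF True] order_refl, THEN conjunct1, rule_format])
  then show ?thesis by (simp only: 0)
qed (simp add: Cb_enorm_def)

lemma C0_space_diff:
  assumes w: "modulus_of_continuity \<omega>" and f: "f \<in> C0_space k \<omega>" and g: "g \<in> C0_space k \<omega>"
  shows "(\<lambda>x. f x - g x) \<in> C0_space k \<omega>"
proof -
  have fg: "C_k k f" "C_k k g" using f g by (auto simp: C0_space_def Cb_space_def)
  have "Cb_enorm k \<omega> f + Cb_enorm k \<omega> g < \<infinity>"
    using f g by (auto simp: C0_space_def Cb_space_def)
  then have "Cb_enorm k \<omega> (\<lambda>x. f x - g x) < \<infinity>"
    using Cb_enorm_diff[OF fg w] by (rule le_less_trans[rotated])
  moreover have "(mderiv \<alpha> (\<lambda>x. f x - g x) \<longlongrightarrow> 0) at_infinity" if "mi_order \<alpha> \<le> k" for \<alpha>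
    using tendsto_diff[of "mderiv \<alpha> f" 0 at_infinity "mderiv \<alpha> g" 0] that f g
    by (auto simp: C0_space_def mderiv_diff[OF fg])
  moreover have "\<exists>\<delta>>0. \<forall>x y. x \<noteq> y \<and> norm (x - y) < \<delta> \<longrightarrow>
           \<bar>(mderiv \<alpha> (\<lambda>x. f x - g x) x - mderiv \<alpha> (\<lambda>x. f x - g x) y) / \<omega> (norm (x - y))\<bar> < \<epsilon>"
    if a: "mi_order \<alpha> = k" and e: "0 < \<epsilon>" for \<alpha> \<epsilon>
  proof -
    have osc: "\<exists>\<delta>>0. \<forall>x y. x \<noteq> y \<and> norm (x - y) < \<delta> \<longrightarrow>
        \<bar>(mderiv \<alpha> h x - mderiv \<alpha> h y) / \<omega> (norm (x - y))\<bar> < \<epsilon> / 2"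
      if "h \<in> C0_space k \<omega>" for h
    proof -
      have "\<forall>\<epsilon>>0. \<exists>\<delta>>0. \<forall>x y. x \<noteq> y \<and> norm (x - y) < \<delta> \<longrightarrow>
          \<bar>(mderiv \<alpha> h x - mderiv \<alpha> h y) / \<omega> (norm (x - y))\<bar> < \<epsilon>"
        using that a unfolding C0_space_def by blast
      then show ?thesis using e by (meson half_gt_zero)
    qed
    obtain d where d: "d > 0" "\<And>x y. x \<noteq> y \<Longrightarrow> norm (x - y) < d \<Longrightarrow>
        \<bar>(mderiv \<alpha> f x - mderiv \<alpha> f y) / \<omega> (norm (x - y))\<bar> < \<epsilon> / 2"
      using osc[OF f] by blast
    obtain d' where d': "d' > 0" "\<And>x y. x \<noteq> y \<Longrightarrow> norm (x - y) < d' \<Longrightarrow>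
        \<bar>(mderiv \<alpha> g x - mderiv \<alpha> g y) / \<omega> (norm (x - y))\<bar> < \<epsilon> / 2"
      using osc[OF g] by blast
    show ?thesis
    proof (intro exI[of _ "min d d'"] conjI allI impI)
      fix x y :: "real^'a" assume xy: "x \<noteq> y \<and> norm (x - y) < min d d'"
      have "(mderiv \<alpha> (\<lambda>x. f x - g x) x - mderiv \<alpha> (\<lambda>x. f x - g x) y) / \<omega> (norm (x - y))
        = (mderiv \<alpha> f x - mderiv \<alpha> f y) / \<omega> (norm (x - y)) - (mderiv \<alpha> g x - mderiv \<alpha> g y) / \<omega> (norm (x - y))"
        using a by (simp add: mderiv_diff[OF fg] diff_divide_distrib)
      with xy d(2)[of x y] d'(2)[of x y]
      show "\<bar>(mderiv \<alpha> (\<lambda>x. f x - g x) x - mderiv \<alpha> (\<lambda>x. f x - g x) y) / \<omega> (norm (x - y))\<bar> < \<epsilon>"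
        by linarith
    qed (use d d' in auto)
  qed
  ultimately show ?thesis using C_k_diff[OF fg] unfolding C0_space_def Cb_space_def by blast
qed

lemma C0_space_finite: "f \<in> C0_space k \<omega> \<Longrightarrow> Cb_enorm k \<omega> f < top"
  by (simp add: C0_space_def Cb_space_def)

lemma Metric_space_C0:
  assumes w: "modulus_of_continuity \<omega>"
  shows "Metric_space (C0_space k \<omega>) (\<lambda>f g. Cb_norm k \<omega> (\<lambda>x. f x - g x))"
proof
  fix f g h :: "real^'a \<Rightarrow> real"
  show "0 \<le> Cb_norm k \<omega> (\<lambda>x. f x - g x)" by (simp add: Cb_norm_def)
  show "Cb_norm k \<omega> (\<lambda>x. f x - g x) = Cb_norm k \<omega> (\<lambda>x. g x - f x)"
    unfolding Cb_norm_def by (rule arg_cong[OF Cb_enorm_minus[OF w]])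
  assume f: "f \<in> C0_space k \<omega>" and g: "g \<in> C0_space k \<omega>"
  note fg = C0_space_diff[OF w f g]
  show "Cb_norm k \<omega> (\<lambda>x. f x - g x) = 0 \<longleftrightarrow> f = g"
  proof
    assume "Cb_norm k \<omega> (\<lambda>x. f x - g x) = 0"
    then have "Cb_enorm k \<omega> (\<lambda>x. f x - g x) = 0"
      using C0_space_finite[OF fg] by (auto simp: Cb_norm_def enn2real_eq_0_iff)
    then have "f x - g x = 0" for x
      using abs_le_Cb_enorm[of "\<lambda>x. f x - g x" x k \<omega>] by simp
    then show "f = g" by (simp add: fun_eq_iff)
  qed (simp add: Cb_norm_def Cb_enorm_zero)
  assume h: "h \<in> C0_space k \<omega>"
  note hg = C0_space_diff[OF w h g]
  have "Cb_enorm k \<omega> (\<lambda>x. (f x - g x) - (h x - g x))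
      \<le> Cb_enorm k \<omega> (\<lambda>x. f x - g x) + Cb_enorm k \<omega> (\<lambda>x. h x - g x)"
    using fg hg by (intro Cb_enorm_diff w) (auto simp: C0_space_def Cb_space_def)
  then show "Cb_norm k \<omega> (\<lambda>x. f x - h x) \<le> Cb_norm k \<omega> (\<lambda>x. f x - g x) + Cb_norm k \<omega> (\<lambda>x. g x - h x)"
    using C0_space_finite[OF fg] C0_space_finite[OF hg]
    unfolding Cb_norm_def Cb_enorm_minus[OF w, where g = g and f = h]
    by (subst enn2real_plus[symmetric]) (auto intro: enn2real_mono)
qed

lemma Metric_space_C0_trace:
  assumes w: "modulus_of_continuity \<omega>"
  shows "Metric_space (C0_trace k \<omega> S) (\<lambda>g h. trace_norm k \<omega> S (\<lambda>x. g x - h x))"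
proof
  define E where "E h = (INF F\<in>{F \<in> C0_space k \<omega>. \<forall>x\<in>S. F x = h x}. Cb_enorm k \<omega> F)"
    for h :: "real^'a \<Rightarrow> real"
  have tr: "trace_norm k \<omega> S h = enn2real (E h)" for h by (simp add: trace_norm_def E_def)
  have z: "(\<lambda>x::real^'a. 0) \<in> C0_space k \<omega>" if "F \<in> C0_space k \<omega>" for F :: "real^'a \<Rightarrow> real"
    using C0_space_diff[OF w that that] by simp
  have E_le: "E h \<le> Cb_enorm k \<omega> F" if "F \<in> C0_space k \<omega>" "\<forall>x\<in>S. F x = h x" for F h
    unfolding E_def using that by (intro INF_lower) auto
  have neg: "E (\<lambda>x. g x - f x) \<le> E (\<lambda>x. f x - g x)" for f g
    unfolding E_def[of "\<lambda>x. f x - g x"]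
  proof (rule INF_greatest, safe)
    fix F assume F: "F \<in> C0_space k \<omega>" "\<forall>x\<in>S. F x = f x - g x"
    have "E (\<lambda>x. g x - f x) \<le> Cb_enorm k \<omega> (\<lambda>x. 0 - F x)"
      using F by (intro E_le C0_space_diff[OF w z]) auto
    then show "E (\<lambda>x. g x - f x) \<le> Cb_enorm k \<omega> F"
      using Cb_enorm_minus[OF w, of k "\<lambda>x. 0" F] by simp
  qed
  have fin: "E (\<lambda>x. f x - g x) < top" if fg: "f \<in> C0_trace k \<omega> S" "g \<in> C0_trace k \<omega> S" for f g
  proof -
    obtain F G where "F \<in> C0_space k \<omega>" "f = restrict F S" "G \<in> C0_space k \<omega>" "g = restrict G S"
      using fg by (auto simp: C0_trace_def)
    then show ?thesis
      using E_le[of "\<lambda>x. F x - G x" "\<lambda>x. f x - g x"] C0_space_diff[OF w, of F k G]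
        C0_space_finite[of "\<lambda>x. F x - G x" k \<omega>] by (auto intro: le_less_trans)
  qed
  fix f g h :: "real^'a \<Rightarrow> real"
  show "0 \<le> trace_norm k \<omega> S (\<lambda>x. f x - g x)" by (simp add: tr)
  show "trace_norm k \<omega> S (\<lambda>x. f x - g x) = trace_norm k \<omega> S (\<lambda>x. g x - f x)"
    unfolding tr using neg[of f g] neg[of g f] by (metis antisym)
  assume f: "f \<in> C0_trace k \<omega> S" and g: "g \<in> C0_trace k \<omega> S"
  show "trace_norm k \<omega> S (\<lambda>x. f x - g x) = 0 \<longleftrightarrow> f = g"
  proof
    assume "trace_norm k \<omega> S (\<lambda>x. f x - g x) = 0"
    then have 0: "E (\<lambda>x. f x - g x) = 0" using fin[OF f g] by (auto simp: tr enn2real_eq_0_iff)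
    have "f x = g x" if x: "x \<in> S" for x
    proof -
      have "ennreal \<bar>f x - g x\<bar> \<le> E (\<lambda>x. f x - g x)"
        unfolding E_def
      proof (rule INF_greatest, safe)
        fix F assume "F \<in> C0_space k \<omega>" "\<forall>x\<in>S. F x = f x - g x"
        with x abs_le_Cb_enorm[of F x k \<omega>] show "ennreal \<bar>f x - g x\<bar> \<le> Cb_enorm k \<omega> F" by simp
      qed
      then show ?thesis using 0 by simp
    qed
    then show "f = g" using f g by (fastforce simp: C0_trace_def fun_eq_iff)
  next
    assume "f = g"
    moreover obtain F :: "real^'a \<Rightarrow> real" where "F \<in> C0_space k \<omega>" using f by (auto simp: C0_trace_def)
    ultimately show "trace_norm k \<omega> S (\<lambda>x. f x - g x) = 0"
      using E_le[OF z[of F], of "\<lambda>x. 0"] by (simp add: tr Cb_enorm_zero)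
  qed
  assume h: "h \<in> C0_trace k \<omega> S"
  have *: "E (\<lambda>x. f x - h x) \<le> Cb_enorm k \<omega> F + Cb_enorm k \<omega> G"
    if "F \<in> C0_space k \<omega>" "\<forall>x\<in>S. F x = f x - g x" "G \<in> C0_space k \<omega>" "\<forall>x\<in>S. G x = h x - g x" for F G
  proof -
    have "E (\<lambda>x. f x - h x) \<le> Cb_enorm k \<omega> (\<lambda>x. F x - G x)"
      using that by (intro E_le C0_space_diff w) auto
    also have "\<dots> \<le> Cb_enorm k \<omega> F + Cb_enorm k \<omega> G"
      using that by (intro Cb_enorm_diff w) (auto simp: C0_space_def Cb_space_def)
    finally show ?thesis .
  qed
  have "E (\<lambda>x. f x - h x) \<le> E (\<lambda>x. f x - g x) + E (\<lambda>x. h x - g x)"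
  proof (rule ennreal_le_epsilon)
    fix e :: real assume e: "0 < e"
    have ex: "\<exists>F. F \<in> C0_space k \<omega> \<and> (\<forall>x\<in>S. F x = u x) \<and> Cb_enorm k \<omega> F < E u + ennreal (e/2)"
      if "E u < top" for u
    proof -
      have "E u < E u + ennreal (e/2)" using that e by (cases "E u") (auto simp: ennreal_plus[symmetric] ennreal_less_iff simp del: ennreal_plus)
      then show ?thesis unfolding E_def[of u] INF_less_iff by auto
    qed
    obtain F where F: "F \<in> C0_space k \<omega>" "\<forall>x\<in>S. F x = f x - g x" "Cb_enorm k \<omega> F < E (\<lambda>x. f x - g x) + ennreal (e/2)"
      using ex[OF fin[OF f g]] by auto
    obtain G where G: "G \<in> C0_space k \<omega>" "\<forall>x\<in>S. G x = h x - g x" "Cb_enorm k \<omega> G < E (\<lambda>x. h x - g x) + ennreal (e/2)"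
      using ex[OF fin[OF h g]] by auto
    have "E (\<lambda>x. f x - h x) \<le> (E (\<lambda>x. f x - g x) + ennreal (e/2)) + (E (\<lambda>x. h x - g x) + ennreal (e/2))"
      by (rule order_trans[OF *[OF F(1,2) G(1,2)] add_mono]) (use F G in auto)
    also have "\<dots> = E (\<lambda>x. f x - g x) + E (\<lambda>x. h x - g x) + (ennreal (e/2) + ennreal (e/2))"
      by (simp add: ac_simps)
    also have "ennreal (e/2) + ennreal (e/2) = ennreal e"
      using e by (subst ennreal_plus[symmetric]) auto
    finally show "E (\<lambda>x. f x - h x) \<le> E (\<lambda>x. f x - g x) + E (\<lambda>x. h x - g x) + ennreal e" .
  qed
  moreover have "E (\<lambda>x. h x - g x) = E (\<lambda>x. g x - h x)" using neg[of g h] neg[of h g] by (rule antisym[rotated])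
  ultimately show "trace_norm k \<omega> S (\<lambda>x. f x - h x)
      \<le> trace_norm k \<omega> S (\<lambda>x. f x - g x) + trace_norm k \<omega> S (\<lambda>x. g x - h x)"
    using fin[OF f g] fin[OF g h] unfolding tr
    by (subst enn2real_plus[symmetric]) (auto intro: enn2real_mono)
qed

end

theory Submission
  imports Defs "HOL-Computational_Algebra.Polynomial"
begin

text \<open>
  Density. Let \<open>f\<close> be in \<open>C\<^sub>0\<^sup>k\<^sup>,\<^sup>\<omega>\<close> and \<open>\<phi>\<close> a smooth probability density supported in a small ball.
  Convolution with \<open>\<phi>\<close> commutes with the derivatives of order at most \<open>k\<close> (\<open>pderivs_conv\<close>). Since
  these are uniformly continuous, they change little in sup norm. For the seminorm, pairs of points
  are split by distance. At distance less than \<open>\<delta>\<close> the increments of \<open>D\<^sup>\<alpha> f\<close> are at most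
  \<open>\<eta> * \<omega>\<close>, and averaging preserves this bound; at larger distances \<open>\<omega>\<close> is bounded below by
  \<open>\<omega> \<delta>\<close> and smallness in sup norm suffices (\<open>Cb_enorm_le_local\<close>, \<open>mollification_close\<close>).

  The function \<open>conv \<phi> f\<close> is smooth but not compactly supported. Instead of multiplying it by a
  smooth cutoff, which calls for the Leibniz rule, \<open>f\<close> is truncated inside the convolution: for a
  continuous cutoff \<open>c\<close>, the function \<open>conv \<phi> (c * f)\<close> is a test function, and every derivative of
  its difference from \<open>conv \<phi> f\<close> is a convolution of a derivative of \<open>\<phi>\<close> with \<open>(1 - c) * f\<close>, which is
  uniformly small because \<open>f\<close> vanishes at infinity (\<open>truncation_close\<close>). Control of one
  derivative more than \<open>k\<close> controls the norm (\<open>Cb_enorm_le_C_Suc\<close>).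

  That test functions belong to the space is where \<open>t / \<omega> t \<longlongrightarrow> 0\<close> is needed: their top derivatives
  are Lipschitz, and Lipschitz increments have to be little-o of \<open>\<omega>\<close> (\<open>Cc_infty_subset_C0\<close>).

  Separability. The same splitting of pairs shows that an element of the space is determined up to a
  small error in norm by finitely many rounded values of its derivatives, together with the scales
  at which its oscillation and its size at infinity are small. These data range over a countable
  set, so the space is separable (\<open>C0_space_codes\<close>, \<open>separable_space_of_codes\<close>); the trace space is
  its image under restriction, which does not increase norms.
\<close>

section \<open>Functions with iterated partial derivatives\<close>

abbreviation has_partial ::
  "(real^'n::finite \<Rightarrow> real) \<Rightarrow> 'n \<Rightarrow> real^'n \<Rightarrow> real \<Rightarrow> bool" where
  "has_partial f i x d \<equiv> ((\<lambda>t. f (x + t *\<^sub>R axis i 1)) has_real_derivative d) (at 0)"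

lemma pderiv_at_eqI: "has_partial f i x d \<Longrightarrow> pderiv_at i f x = d"
  unfolding pderiv_at_def by (rule DERIV_imp_deriv)

text \<open>Partial derivatives are taken at parameter \<open>0\<close> of a coordinate line; moving the base point along
  the line gives the derivative at every parameter, as the mean value theorem and differentiation
  under the integral sign require.\<close>

lemma has_partial_line:
  assumes "has_partial f i (x + s *\<^sub>R axis i 1) d"
  shows "((\<lambda>t. f (x + t *\<^sub>R axis i 1)) has_real_derivative d) (at s)"
proof -
  have "((\<lambda>t. f (x + (t + s) *\<^sub>R axis i 1)) has_real_derivative d) (at 0)"
    using assms by (simp add: scaleR_add_left ac_simps)
  then show ?thesis
    using DERIV_shift[of "\<lambda>t. f (x + t *\<^sub>R axis i 1)" d 0 s] by simp
qed

lemma pderivs_append: "pderivs (v @ w) f = pderivs v (pderivs w f)"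
  by (induction v) auto

lemma pderivs_snoc: "pderivs (w @ [i]) f = pderivs w (pderiv_at i f)"
  by (simp add: pderivs_append)

lemma C_k_has_partial:
  assumes "C_k k f" "length w < k"
  shows "has_partial (pderivs w f) i x (pderivs (i # w) f x)"
proof -
  have "(\<lambda>t. pderivs w f (x + t *\<^sub>R axis i 1)) differentiable (at 0)"
    using assms by (auto simp: C_k_def)
  then show ?thesis
    by (simp add: pderiv_at_def DERIV_deriv_iff_real_differentiable)
qed

lemma C_k_continuous: "C_k k f \<Longrightarrow> length w \<le> k \<Longrightarrow> continuous_on UNIV (pderivs w f)"
  by (auto simp: C_k_def)

lemma C_k_continuous_self: "C_k k f \<Longrightarrow> continuous_on UNIV f"
  using C_k_continuous[of k f "[]"] by simp

lemma C_k_mono: "C_k k f \<Longrightarrow> j \<le> k \<Longrightarrow> C_k j f"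
  unfolding C_k_def using le_trans less_le_trans by blast

lemma C_k_pderivs:
  assumes "C_k k f" "length w + j \<le> k"
  shows "C_k j (pderivs w f)"
  unfolding C_k_def pderivs_append[symmetric]
proof (intro conjI allI impI)
  show "continuous_on UNIV (pderivs (v @ w) f)" if "length v \<le> j" for v
    using assms that by (intro C_k_continuous) auto
  show "(\<lambda>t. pderivs (v @ w) f (x + t *\<^sub>R axis i 1)) differentiable at 0"
    if "length v < j" for v i x
    using C_k_has_partial[OF assms(1), where w = "v @ w" and i = i and x = x] assms(2) that
    by (auto simp: real_differentiable_def)
qed

text \<open>Membership in \<open>C\<^sup>k\<close> is proved by induction on \<open>k\<close> with the innermost derivative split off, so
  that the induction hypothesis applies to the explicitly known first-order partial derivatives.\<close>

lemma C_k_SucI: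
  assumes "continuous_on UNIV f" and d: "\<And>i x. has_partial f i x (g i x)" and g: "\<And>i. C_k k (g i)"
  shows "C_k (Suc k) f"
proof -
  have p: "pderiv_at i f = g i" for i
    using pderiv_at_eqI[OF d] by blast
  show ?thesis
    unfolding C_k_def
  proof (intro conjI allI impI)
    fix w :: "'a list" assume "length w \<le> Suc k"
    then show "continuous_on UNIV (pderivs w f)"
      by (cases w rule: rev_cases) (use assms(1) g in \<open>auto simp: pderivs_snoc p C_k_def\<close>)
  next
    fix w :: "'a list" and i x assume "length w < Suc k"
    then show "(\<lambda>t. pderivs w f (x + t *\<^sub>R axis i 1)) differentiable at 0"
      by (cases w rule: rev_cases)
        (use d g in \<open>auto simp: pderivs_snoc p C_k_def real_differentiable_def\<close>)
  qed
qed

lemma C_k_0: "C_k 0 f \<longleftrightarrow> continuous_on UNIV f"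
  by (simp add: C_k_def)

lemma C_k_const: "C_k k (\<lambda>x. c)"
proof (induction k arbitrary: c)
  case (Suc k)
  show ?case by (rule C_k_SucI[where g = "\<lambda>i x. 0"]) (auto intro: Suc)
qed (simp add: C_k_0)

lemma C_k_add:
  assumes "C_k k f" "C_k k g"
  shows "C_k k (\<lambda>x. f x + g x)"
  using C_k_diff[OF assms(1) C_k_diff[OF C_k_zero assms(2)]] by simp

lemma C_k_mult: "C_k k f \<Longrightarrow> C_k k g \<Longrightarrow> C_k k (\<lambda>x. f x * g x)"
proof (induction k arbitrary: f g)
  case 0
  then show ?case by (auto simp: C_k_0 intro: continuous_on_mult)
next
  case (Suc k)
  have c: "C_k k f" "C_k k g" using Suc.prems by (auto intro: C_k_mono)
  have d: "C_k k (pderiv_at i f)" "C_k k (pderiv_at i g)" for i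
    using C_k_pderivs[OF Suc.prems(1), of "[i]" k] C_k_pderivs[OF Suc.prems(2), of "[i]" k] by auto
  show ?case
  proof (rule C_k_SucI[where g = "\<lambda>i x. pderiv_at i f x * g x + pderiv_at i g x * f x"])
    show "continuous_on UNIV (\<lambda>x. f x * g x)"
      using Suc.prems by (intro continuous_on_mult C_k_continuous_self)
    show "has_partial (\<lambda>x. f x * g x) i x (pderiv_at i f x * g x + pderiv_at i g x * f x)" for i x
      using DERIV_mult[OF C_k_has_partial[OF Suc.prems(1), where w = "[]" and i = i and x = x]
          C_k_has_partial[OF Suc.prems(2), where w = "[]" and i = i and x = x]] by simp
    show "C_k k (\<lambda>x. pderiv_at i f x * g x + pderiv_at i g x * f x)" for i
      by (intro C_k_add Suc.IH c d)
  qed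
qed

lemma C_k_nth: "C_k k (\<lambda>x. x $ j)"
proof (cases k)
  case 0
  then show ?thesis by (simp add: C_k_0 continuous_on_component)
next
  case (Suc m)
  show ?thesis unfolding Suc
  proof (rule C_k_SucI[where g = "\<lambda>i x. axis i 1 $ j"])
    show "has_partial (\<lambda>x. x $ j) i x (axis i 1 $ j)" for i and x :: "real^'a"
      by (auto intro!: derivative_eq_intros)
  qed (auto intro: C_k_const continuous_on_component)
qed

text \<open>A family of functions of one variable that is closed under derivation can be composed with
  a smooth function: each partial derivative of the composite is again such a composite times a
  smooth factor.\<close>

lemma C_k_compose:
  assumes G: "\<And>g. g \<in> G \<Longrightarrow> \<exists>g'\<in>G. \<forall>t. (g has_real_derivative g' t) (at t)"
    and u: "\<And>m. C_k m u" and "g \<in> G"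
  shows "C_k k (\<lambda>x. g (u x))"
  using \<open>g \<in> G\<close>
proof (induction k arbitrary: g)
  case 0
  obtain g' where "\<And>t. (g has_real_derivative g' t) (at t)" using G[OF 0] by blast
  then have "continuous_on UNIV g" by (meson DERIV_isCont continuous_at_imp_continuous_on)
  then show ?case
    using continuous_on_compose2[OF _ C_k_continuous_self[OF u], of UNIV g] by (simp add: C_k_0)
next
  case (Suc k)
  obtain g' where g': "g' \<in> G" "\<And>t. (g has_real_derivative g' t) (at t)" using G[OF Suc.prems] by blast
  have "continuous_on UNIV g" by (meson g'(2) DERIV_isCont continuous_at_imp_continuous_on)
  then have "continuous_on UNIV (\<lambda>x. g (u x))"
    using continuous_on_compose2[OF _ C_k_continuous_self[OF u], of UNIV g] by simp
  moreover have "has_partial (\<lambda>x. g (u x)) i x (g' (u x) * pderiv_at i u x)" for i x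
    using DERIV_chain2[OF g'(2) C_k_has_partial[OF u[of 1], where w = "[]" and i = i and x = x]] by simp
  moreover have "C_k k (\<lambda>x. g' (u x) * pderiv_at i u x)" for i
    using C_k_mult[OF Suc.IH[OF g'(1)] C_k_pderivs[OF u, of "[i]" k "Suc k"]] by simp
  ultimately show ?case by (rule C_k_SucI)
qed

lemma pderivs_cong_open:
  assumes "open U" "\<And>x. x \<in> U \<Longrightarrow> f x = g x" "x \<in> U"
  shows "pderivs w f x = pderivs w g x"
  using assms(3)
proof (induction w arbitrary: x)
  case (Cons i w)
  have "open ((\<lambda>t::real. x + t *\<^sub>R axis i 1) -` U)"
    by (intro open_vimage assms(1) continuous_intros)
  moreover have "0 \<in> (\<lambda>t::real. x + t *\<^sub>R axis i 1) -` U" using Cons.prems by simp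
  ultimately have "\<forall>\<^sub>F t in nhds 0. pderivs w f (x + t *\<^sub>R axis i 1) = pderivs w g (x + t *\<^sub>R axis i 1)"
    unfolding eventually_nhds using Cons.IH by blast
  then show ?case by (simp add: pderiv_at_def deriv_cong_ev)
qed (use assms(2) in auto)

text \<open>Changing one coordinate at a time reduces the estimate to the mean value theorem in one
  variable.\<close>

lemma lipschitz_of_partials:
  fixes f :: "real^'n::finite \<Rightarrow> real"
  assumes d: "\<And>i x. has_partial f i x (g i x)" and b: "\<And>i x. \<bar>g i x\<bar> \<le> L"
  shows "\<bar>f x - f y\<bar> \<le> real CARD('n) * L * norm (x - y)"
proof -
  have step: "\<bar>f (x + s *\<^sub>R axis i 1) - f x\<bar> \<le> L * \<bar>s\<bar>" for x s i
  proof -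
    have "norm (f (x + s *\<^sub>R axis i 1) - f (x + 0 *\<^sub>R axis i 1)) \<le> L * norm (s - 0)"
    proof (rule field_differentiable_bound[OF convex_UNIV, where f = "\<lambda>s. f (x + s *\<^sub>R axis i 1)"])
      show "((\<lambda>s. f (x + s *\<^sub>R axis i 1)) has_field_derivative g i (x + s *\<^sub>R axis i 1)) (at s within UNIV)" for s
        by (rule has_partial_line[OF d])
    qed (use b in auto)
    then show ?thesis by simp
  qed
  have "\<bar>f (\<chi> i. if i \<in> A then x $ i else y $ i) - f y\<bar> \<le> (\<Sum>i\<in>A. L * \<bar>x $ i - y $ i\<bar>)" for A
    using finite[of A]
  proof (induction A)
    case empty
    then show ?case by simp
  next
    case (insert j A)
    let ?z = "\<chi> i. if i \<in> A then x $ i else y $ i"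
    \<comment> \<open>Adding \<open>j\<close> to \<open>A\<close> moves the point along the \<open>j\<close>-th coordinate line.\<close>
    have "(\<chi> i. if i \<in> insert j A then x $ i else y $ i) = ?z + (x $ j - y $ j) *\<^sub>R axis j 1"
      using insert.hyps by (auto simp: vec_eq_iff axis_def)
    then show ?case using insert step[of ?z "x $ j - y $ j" j] by auto
  qed
  from this[of UNIV] have "\<bar>f x - f y\<bar> \<le> (\<Sum>i\<in>UNIV. L * \<bar>(x - y) $ i\<bar>)" by simp
  also have "\<dots> \<le> (\<Sum>i\<in>(UNIV::'n set). L * norm (x - y))"
    using b[of undefined undefined] by (intro sum_mono mult_left_mono component_le_norm_cart) linarith
  finally show ?thesis by (simp add: mult.assoc)
qed

section \<open>Convolution\<close>

definition conv :: "(real^'n::finite \<Rightarrow> real) \<Rightarrow> (real^'n \<Rightarrow> real) \<Rightarrow> real^'n \<Rightarrow> real" where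
  "conv u v x = integral UNIV (\<lambda>y. u y * v (x - y))"

lemma integral_UNIV_eq_cbox:
  fixes g :: "real^'n::finite \<Rightarrow> real"
  assumes "\<And>y. y \<notin> cbox a b \<Longrightarrow> g y = 0"
  shows "integral UNIV g = integral (cbox a b) g"
proof -
  have "(\<lambda>y. if y \<in> cbox a b then g y else 0) = g" using assms by auto
  then show ?thesis using integral_restrict_UNIV[of "cbox a b" g] by simp
qed

lemma bounded_support_box:
  fixes g :: "real^'n::finite \<Rightarrow> real"
  assumes "bounded {x. g x \<noteq> 0}"
  obtains a where "\<And>y. y \<notin> cbox (- a) a \<Longrightarrow> g y = 0"
proof -
  obtain a where a: "{x. g x \<noteq> 0} \<subseteq> cbox (- a) a"
    using assms by (rule bounded_subset_cbox_symmetric)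
  show ?thesis by (rule that[of a]) (use a in auto)
qed

lemma integrable_bounded_support:
  fixes g :: "real^'n::finite \<Rightarrow> real"
  assumes "continuous_on UNIV g" "bounded {x. g x \<noteq> 0}"
  shows "g integrable_on UNIV"
proof -
  obtain a where a: "\<And>y. y \<notin> cbox (- a) a \<Longrightarrow> g y = 0" using bounded_support_box[OF assms(2)] by blast
  have "g integrable_on cbox (- a) a"
    by (intro integrable_continuous continuous_on_subset[OF assms(1)]) simp
  then show ?thesis using a by (rule integrable_on_superset) auto
qed

text \<open>Lebesgue measure is invariant under the reflection \<open>y \<mapsto> x - y\<close>; this is what makes convolution
  commutative.\<close>

lemma integral_reflect_shift:
  fixes g :: "real^'n::finite \<Rightarrow> real"
  assumes "continuous_on UNIV g" "bounded {x. g x \<noteq> 0}"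
  shows "integral UNIV (\<lambda>y. g (x - y)) = integral UNIV g"
proof -
  obtain a where a: "\<And>y. y \<notin> cbox (- a) a \<Longrightarrow> g y = 0" using bounded_support_box[OF assms(2)] by blast
  have "g integrable_on cbox (- a) a"
    by (intro integrable_continuous continuous_on_subset[OF assms(1)]) simp
  moreover have "integral UNIV g = integral (cbox (- a) a) g"
    by (rule integral_UNIV_eq_cbox) (rule a)
  ultimately have "(g has_integral integral UNIV g) (cbox (- a) a)"
    by (simp add: integrable_integral)
  from has_integral_affinity[OF this, of "-1" x]
  have "((\<lambda>y. g (x - y)) has_integral integral UNIV g) ((\<lambda>y. x - y) ` cbox (- a) a)"
    by (simp only: power_one abs_minus abs_one div_by_1 divide_minus_right scaleR_one scaleR_minus_left
        minus_minus uminus_add_conv_diff zero_neq_neg_one not_False_eq_True)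
  then have "((\<lambda>y. g (x - y)) has_integral integral UNIV g) UNIV"
  proof (rule has_integral_on_superset)
    fix y assume "y \<notin> (\<lambda>y. x - y) ` cbox (- a) a"
    moreover have "y = x - (x - y)" by simp
    ultimately have "x - y \<notin> cbox (- a) a" by blast
    then show "g (x - y) = 0" by (rule a)
  qed simp
  then show ?thesis by (rule integral_unique)
qed

text \<open>If one factor vanishes outside a bounded set, then for \<open>x\<close> near a given point the
  integrands defining \<open>conv u v x\<close> all live in one box. This reduces convolutions to parameter
  integrals over a fixed box.\<close>

lemma conv_common_box:
  fixes A B :: "(real^'n::finite) set"
  assumes "bounded A \<or> bounded B"
  obtains a where "\<And>x y. x \<in> ball x0 1 \<Longrightarrow> y \<in> A \<Longrightarrow> x - y \<in> B \<Longrightarrow> y \<in> cbox (- a) a"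
proof -
  have "bounded {y \<in> A. \<exists>x\<in>ball x0 1. x - y \<in> B}"
    using assms
  proof
    assume "bounded A"
    then show ?thesis by (rule bounded_subset) auto
  next
    assume "bounded B"
    then have "bounded ((\<lambda>(x, z). x - z) ` (ball x0 1 \<times> B))"
      by (rule bounded_minus[OF bounded_ball])
    then show ?thesis
    proof (rule bounded_subset)
      show "{y \<in> A. \<exists>x\<in>ball x0 1. x - y \<in> B} \<subseteq> (\<lambda>(x, z). x - z) ` (ball x0 1 \<times> B)"
      proof safe
        fix y x assume "x \<in> ball x0 1" "x - y \<in> B"
        then show "y \<in> (\<lambda>(x, z). x - z) ` (ball x0 1 \<times> B)"
          by (intro image_eqI[where x = "(x, x - y)"]) simp_all
      qed
    qed
  qed
  then obtain a where a: "{y \<in> A. \<exists>x\<in>ball x0 1. x - y \<in> B} \<subseteq> cbox (- a) a"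
    by (rule bounded_subset_cbox_symmetric)
  show ?thesis
    by (rule that[OF subsetD[OF a]]) blast
qed

lemma conv_eq_box_integral:
  fixes u v :: "real^'n::finite \<Rightarrow> real"
  assumes "\<And>y. u y \<noteq> 0 \<Longrightarrow> v (x - y) \<noteq> 0 \<Longrightarrow> y \<in> cbox (- a) a"
  shows "conv u v x = integral (cbox (- a) a) (\<lambda>y. u y * v (x - y))"
  unfolding conv_def by (rule integral_UNIV_eq_cbox) (use assms in auto)

lemma conv_integrand_continuous:
  fixes u v :: "real^'n::finite \<Rightarrow> real" and p :: "'b::topological_space \<Rightarrow> real^'n"
  assumes "continuous_on UNIV u" "continuous_on UNIV v" "continuous_on U p"
  shows "continuous_on (U \<times> K) (\<lambda>(t, y). u y * v (p t - y))"
  unfolding split_beta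
  by (intro continuous_intros continuous_on_compose2[OF assms(1)] continuous_on_compose2[OF assms(2)]
      continuous_on_compose2[OF assms(3)]) auto

lemma continuous_on_conv:
  fixes u v :: "real^'n::finite \<Rightarrow> real"
  assumes "continuous_on UNIV u" "continuous_on UNIV v"
    and "bounded {x. u x \<noteq> 0} \<or> bounded {x. v x \<noteq> 0}"
  shows "continuous_on UNIV (conv u v)"
proof -
  have "isCont (conv u v) x0" for x0
  proof -
    obtain a where a: "\<And>x y. x \<in> ball x0 1 \<Longrightarrow> y \<in> {x. u x \<noteq> 0} \<Longrightarrow> x - y \<in> {x. v x \<noteq> 0} \<Longrightarrow> y \<in> cbox (- a) a"
      using conv_common_box[OF assms(3)] by metis
    have "continuous_on (ball x0 1) (\<lambda>x. integral (cbox (- a) a) (\<lambda>y. u y * v (x - y)))"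
      by (intro integral_continuous_on_param conv_integrand_continuous assms(1,2) continuous_on_id)
    then have "continuous_on (ball x0 1) (conv u v)"
      by (rule continuous_on_eq) (use a in \<open>auto intro!: conv_eq_box_integral[symmetric]\<close>)
    then show ?thesis by (simp add: continuous_on_eq_continuous_at)
  qed
  then show ?thesis by (simp add: continuous_at_imp_continuous_on)
qed

text \<open>Differentiation under the integral sign over the common box. The derivative \<open>v'\<close> is included in
  the support condition because its integrand has to be confined to the same box.\<close>

lemma conv_has_partial:
  fixes u v :: "real^'n::finite \<Rightarrow> real"
  assumes u: "continuous_on UNIV u" and v: "continuous_on UNIV v" and v': "continuous_on UNIV v'"
    and d: "\<And>x. has_partial v i x (v' x)"
    and b: "bounded {x. u x \<noteq> 0} \<or> bounded {x. v x \<noteq> 0 \<or> v' x \<noteq> 0}"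
  shows "has_partial (conv u v) i x0 (conv u v' x0)"
proof -
  obtain a where a: "\<And>x y. x \<in> ball x0 1 \<Longrightarrow> y \<in> {x. u x \<noteq> 0} \<Longrightarrow> x - y \<in> {x. v x \<noteq> 0 \<or> v' x \<noteq> 0}
      \<Longrightarrow> y \<in> cbox (- a) a"
    by (rule conv_common_box[OF b, of x0]) blast
  let ?e = "\<lambda>t. t *\<^sub>R axis i (1::real)"
  have near: "x0 + ?e t \<in> ball x0 1" if "t \<in> {-1<..<1}" for t
    using that by (auto simp: dist_norm)
  have "((\<lambda>t. integral (cbox (- a) a) (\<lambda>y. u y * v (x0 + ?e t - y))) has_field_derivative
      integral (cbox (- a) a) (\<lambda>y. u y * v' (x0 + ?e 0 - y))) (at 0 within {-1<..<1})"
  proof (rule leibniz_rule_field_derivative)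
    fix t :: real and y :: "real^'n"
    have "((\<lambda>t. v (x0 - y + ?e t)) has_real_derivative v' (x0 - y + ?e t)) (at t)"
      by (rule has_partial_line[OF d])
    then have "((\<lambda>t. u y * v (x0 - y + ?e t)) has_real_derivative u y * v' (x0 - y + ?e t)) (at t)"
      by (rule DERIV_cmult)
    then show "((\<lambda>t. u y * v (x0 + ?e t - y)) has_field_derivative u y * v' (x0 + ?e t - y)) (at t within {-1<..<1})"
      by (simp add: algebra_simps has_field_derivative_at_within)
  next
    fix t :: real
    show "(\<lambda>y. u y * v (x0 + ?e t - y)) integrable_on cbox (- a) a"
      by (intro integrable_continuous continuous_intros continuous_on_compose2[OF u] continuous_on_compose2[OF v]) auto
  next
    show "continuous_on ({-1<..<1} \<times> cbox (- a) a) (\<lambda>(t, y). u y * v' (x0 + ?e t - y))"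
      by (intro conv_integrand_continuous u v' continuous_intros)
  qed auto
  moreover have "conv u v' x0 = integral (cbox (- a) a) (\<lambda>y. u y * v' (x0 + ?e 0 - y))"
    using a[of x0] by (simp add: conv_eq_box_integral)
  moreover have "integral (cbox (- a) a) (\<lambda>y. u y * v (x0 + ?e t - y)) = conv u v (x0 + ?e t)"
    if "t \<in> {-1<..<1}" for t
    using a[OF near[OF that]] by (intro conv_eq_box_integral[symmetric]) auto
  ultimately have "((\<lambda>t. conv u v (x0 + ?e t)) has_field_derivative conv u v' x0) (at 0 within {-1<..<1})"
    by (intro has_field_derivative_transform_within[where d = 1 and g = "\<lambda>t. conv u v (x0 + ?e t)"
        and f = "\<lambda>t. integral (cbox (- a) a) (\<lambda>y. u y * v (x0 + ?e t - y))"]) simp_all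
  then show ?thesis by (simp add: at_within_open[of 0 "{-1<..<1}"])
qed

text \<open>Derivatives are local, so they vanish wherever the function vanishes in a neighbourhood.\<close>

lemma pderivs_support: "{x. pderivs w f x \<noteq> 0} \<subseteq> closure {x. f x \<noteq> 0}"
proof safe
  fix x assume x: "pderivs w f x \<noteq> 0"
  show "x \<in> closure {x. f x \<noteq> 0}"
  proof (rule ccontr)
    assume "x \<notin> closure {x. f x \<noteq> 0}"
    then have "x \<in> - closure {x. f x \<noteq> 0}" by simp
    moreover have "f y = 0" if "y \<in> - closure {x. f x \<noteq> 0}" for y
      using that closure_subset[of "{x. f x \<noteq> 0}"] by auto
    ultimately have "pderivs w f x = pderivs w (\<lambda>_. 0) x"
      by (intro pderivs_cong_open[OF open_Compl[OF closed_closure]])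
    with x show False by (simp add: pderivs_zero)
  qed
qed

lemma bounded_pderivs_support: "bounded {x. f x \<noteq> 0} \<Longrightarrow> bounded {x. pderivs w f x \<noteq> 0}"
  by (rule bounded_subset[OF bounded_closure pderivs_support])

text \<open>Derivatives of a convolution fall on either factor, so mollifying commutes with the
  derivatives that the function has, and creates as many as the kernel has.\<close>

lemma pderivs_conv:
  fixes u v :: "real^'n::finite \<Rightarrow> real"
  assumes u: "continuous_on UNIV u" and v: "C_k k v"
    and b: "bounded {x. u x \<noteq> 0} \<or> bounded {x. v x \<noteq> 0}" and "length w \<le> k"
  shows "pderivs w (conv u v) = conv u (pderivs w v)"
    and "length w < k \<Longrightarrow> has_partial (pderivs w (conv u v)) i x (conv u (pderivs (i # w) v) x)"
proof -
  have d: "has_partial (conv u (pderivs w v)) i x (conv u (pderivs (i # w) v) x)"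
    if w: "length w < k" for w i x
  proof (rule conv_has_partial[OF u C_k_continuous[OF v] C_k_continuous[OF v] C_k_has_partial[OF v w]])
    show "bounded {x. u x \<noteq> 0} \<or> bounded {x. pderivs w v x \<noteq> 0 \<or> pderivs (i # w) v x \<noteq> 0}"
      unfolding Collect_disj_eq bounded_Un
      using b bounded_pderivs_support[of v w] bounded_pderivs_support[of v "i # w"] by argo
  qed (use w in simp_all)
  show eq: "pderivs w (conv u v) = conv u (pderivs w v)" using \<open>length w \<le> k\<close>
  proof (induction w)
    case (Cons i w)
    then have "pderivs (i # w) (conv u v) = pderiv_at i (conv u (pderivs w v))" by simp
    also have "\<dots> = conv u (pderivs (i # w) v)"
      using Cons.prems by (intro ext pderiv_at_eqI d) simp
    finally show ?case .
  qed simp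
  show "has_partial (pderivs w (conv u v)) i x (conv u (pderivs (i # w) v) x)" if "length w < k"
    unfolding eq by (rule d[OF that])
qed

lemma C_k_conv:
  fixes u v :: "real^'n::finite \<Rightarrow> real"
  assumes u: "continuous_on UNIV u" and v: "C_k k v"
    and b: "bounded {x. u x \<noteq> 0} \<or> bounded {x. v x \<noteq> 0}"
  shows "C_k k (conv u v)"
  unfolding C_k_def
proof (intro conjI allI impI)
  fix w :: "'n list" assume w: "length w \<le> k"
  show "continuous_on UNIV (pderivs w (conv u v))"
    unfolding pderivs_conv(1)[OF u v b w]
    using b bounded_pderivs_support[of v w] by (intro continuous_on_conv u C_k_continuous[OF v w]) argo
next
  fix w :: "'n list" and i x assume w: "length w < k"
  show "(\<lambda>t. pderivs w (conv u v) (x + t *\<^sub>R axis i 1)) differentiable at 0"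
    using pderivs_conv(2)[OF u v b less_imp_le[OF w] w, where i = i and x = x] by (auto simp: real_differentiable_def)
qed

lemma bounded_support_mult:
  fixes u v :: "real^'n::finite \<Rightarrow> real"
  shows "bounded {x. u x \<noteq> 0} \<Longrightarrow> bounded {x. u x * v x \<noteq> 0}"
  by (erule bounded_subset) auto

lemma conv_integrable:
  fixes u a :: "real^'n::finite \<Rightarrow> real"
  assumes "continuous_on UNIV u" "bounded {x. u x \<noteq> 0}" "continuous_on UNIV a"
  shows "(\<lambda>y. u y * a y) integrable_on UNIV"
  using assms by (intro integrable_bounded_support bounded_support_mult continuous_on_mult)

lemma conv_commute:
  fixes u v :: "real^'n::finite \<Rightarrow> real"
  assumes "continuous_on UNIV u" "bounded {x. u x \<noteq> 0}" "continuous_on UNIV v"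
  shows "conv u v = conv v u"
proof
  fix x
  have "continuous_on UNIV (\<lambda>y. v (x - y))"
    by (intro continuous_intros continuous_on_compose2[OF assms(3)]) auto
  then have "integral UNIV (\<lambda>y. u (x - y) * v (x - (x - y))) = integral UNIV (\<lambda>y. u y * v (x - y))"
    by (intro integral_reflect_shift continuous_on_mult assms(1) bounded_support_mult assms(2))
  then show "conv u v x = conv v u x" by (simp add: conv_def mult.commute)
qed

text \<open>The bound on \<open>a\<close> is only required where the kernel \<open>u\<close> lives, so that for a kernel of small
  support \<open>s\<close> may be an oscillation at small scale.\<close>

lemma kernel_integral_bound:
  fixes u a :: "real^'n::finite \<Rightarrow> real"
  assumes u: "continuous_on UNIV u" "bounded {x. u x \<noteq> 0}" and a: "continuous_on UNIV a"
    and s: "\<And>y. u y \<noteq> 0 \<Longrightarrow> \<bar>a y\<bar> \<le> s"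
  shows "\<bar>integral UNIV (\<lambda>y. u y * a y)\<bar> \<le> s * integral UNIV (\<lambda>y. \<bar>u y\<bar>)"
proof -
  have abs: "(\<lambda>y. \<bar>u y\<bar>) integrable_on UNIV"
    using u by (intro integrable_bounded_support continuous_intros) auto
  have "norm (integral UNIV (\<lambda>y. u y * a y)) \<le> integral UNIV (\<lambda>y. s * \<bar>u y\<bar>)"
  proof (rule integral_norm_bound_integral)
    show "norm (u y * a y) \<le> s * \<bar>u y\<bar>" for y
      using s[of y] by (cases "u y = 0") (auto simp: abs_mult mult.commute intro: mult_right_mono)
  qed (intro conv_integrable u a integrable_on_mult_right abs)+
  also have "\<dots> = s * integral UNIV (\<lambda>y. \<bar>u y\<bar>)" by simp
  finally show ?thesis by simp
qed

lemma conv_diff: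
  fixes u f g :: "real^'n::finite \<Rightarrow> real"
  assumes u: "continuous_on UNIV u" "bounded {x. u x \<noteq> 0}"
    and f: "continuous_on UNIV f" and g: "continuous_on UNIV g"
  shows "conv u f x - conv u g y = integral UNIV (\<lambda>z. u z * (f (x - z) - g (y - z)))"
proof -
  have "(\<lambda>z. u z * h (c - z)) integrable_on UNIV" if "continuous_on UNIV h" for h c
    by (intro conv_integrable u continuous_on_compose2[OF that] continuous_intros) auto
  from integral_diff[OF this[OF f] this[OF g]] show ?thesis
    by (simp add: conv_def right_diff_distrib)
qed

section \<open>Smooth mollifiers\<close>

text \<open>The functions \<open>p (1 / t) * exp (- 1 / t)\<close> on the positive half-line, extended by zero.
  They contain the flat function \<open>exp (- 1 / t)\<close>, and allowing a polynomial factor makes the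
  family closed under derivation.\<close>

definition flat_exp :: "real poly \<Rightarrow> real \<Rightarrow> real" where
  "flat_exp p t = (if 0 < t then poly p (1 / t) * exp (- (1 / t)) else 0)"

lemma poly_times_exp_tendsto_0:
  fixes p :: "real poly"
  shows "((\<lambda>s. poly p s * exp (- s)) \<longlongrightarrow> 0) at_top"
proof -
  have "((\<lambda>s. \<Sum>i\<le>degree p. coeff p i * (s ^ i / exp s)) \<longlongrightarrow> (\<Sum>i\<le>degree p. coeff p i * 0)) at_top"
    by (intro tendsto_sum tendsto_mult tendsto_const tendsto_power_div_exp_0)
  then show ?thesis
    by (simp add: poly_altdef sum_distrib_right exp_minus divide_inverse mult.assoc)
qed

text \<open>The product rule gives \<open>(p - p') (1 / t) * exp (- 1 / t) / t\<^sup>2\<close> for \<open>t > 0\<close>. At the origin the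
  difference quotient from the right is a polynomial in \<open>1 / t\<close> times \<open>exp (- 1 / t)\<close>, and this
  tends to zero.\<close>

lemma flat_exp_DERIV:
  "(flat_exp p has_real_derivative flat_exp ([:0, 0, 1:] * (p - pderiv p)) t) (at t)"
proof -
  consider "t > 0" | "t < 0" | "t = 0" by linarith
  then show ?thesis
  proof cases
    case 1
    have "((\<lambda>t. poly p (1 / t) * exp (- (1 / t))) has_real_derivative
        flat_exp ([:0, 0, 1:] * (p - pderiv p)) t) (at t)"
      using 1 by (auto intro!: derivative_eq_intros DERIV_chain2[OF poly_DERIV]
          simp: flat_exp_def power2_eq_square field_simps)
    then show ?thesis
      by (rule has_field_derivative_transform_within_open[of _ _ _ "{0<..}"])
        (use 1 in \<open>auto simp: flat_exp_def\<close>)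
  next
    case 2
    have "((\<lambda>t. 0) has_real_derivative flat_exp ([:0, 0, 1:] * (p - pderiv p)) t) (at t)"
      using 2 by (simp add: flat_exp_def)
    then show ?thesis
      by (rule has_field_derivative_transform_within_open[of _ _ _ "{..<0}"])
        (use 2 in \<open>auto simp: flat_exp_def\<close>)
  next
    case 3
    have "((\<lambda>h. poly ([:0, 1:] * p) (inverse h) * exp (- inverse h)) \<longlongrightarrow> 0) (at_right 0)"
      by (rule filterlim_compose[OF poly_times_exp_tendsto_0 filterlim_inverse_at_top_right])
    then have r: "((\<lambda>h. flat_exp p h / h) \<longlongrightarrow> 0) (at_right 0)"
      by (rule filterlim_cong[THEN iffD1, rotated -1])
        (auto simp: eventually_at_right_less flat_exp_def divide_inverse eventually_at_filter)
    have l: "((\<lambda>h. flat_exp p h / h) \<longlongrightarrow> 0) (at_left 0)"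
      by (rule tendsto_eventually) (auto simp: flat_exp_def eventually_at_filter)
    have "((\<lambda>h. flat_exp p h / h) \<longlongrightarrow> 0) (at 0)"
      using l r by (simp add: filterlim_split_at)
    then show ?thesis unfolding DERIV_def 3 by (simp add: flat_exp_def)
  qed
qed

text \<open>The flat exponential of \<open>\<epsilon>\<^sup>2 - (norm x)\<^sup>2\<close> is smooth, nonnegative, and nonzero exactly on the open
  ball of radius \<open>\<epsilon>\<close>; it remains to normalise its integral.\<close>

lemma exists_mollifier:
  fixes \<epsilon> :: real
  assumes "0 < \<epsilon>"
  obtains \<phi> :: "real^'n::finite \<Rightarrow> real" where "\<And>m. C_k m \<phi>" "\<And>x. 0 \<le> \<phi> x"
    "\<And>x. \<phi> x \<noteq> 0 \<Longrightarrow> norm x < \<epsilon>" "integral UNIV \<phi> = 1"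
proof -
  define u :: "real^'n \<Rightarrow> real" where "u x = \<epsilon>\<^sup>2 - (norm x)\<^sup>2" for x
  define b :: "real^'n \<Rightarrow> real" where "b x = flat_exp 1 (u x)" for x
  have "C_k m (\<lambda>x. \<Sum>i\<in>A. x $ i * x $ i)" if "finite A" for m and A :: "'n set"
    using that
  proof (induction A)
    case (insert i A)
    have "C_k m (\<lambda>x. x $ i * x $ i + (\<Sum>i\<in>A. x $ i * x $ i))"
      by (rule C_k_add[OF C_k_mult[OF C_k_nth C_k_nth] insert.IH])
    with insert.hyps show ?case by simp
  qed (simp add: C_k_const)
  from C_k_diff[OF C_k_const this[OF finite_class.finite_UNIV]]
  have u: "C_k m u" for m
    by (simp add: u_def[abs_def] power2_norm_eq_inner inner_vec_def)
  have b: "C_k m b" for m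
    unfolding b_def
  proof (rule C_k_compose[where G = "range flat_exp" and g = "flat_exp 1" and u = u])
    show "\<exists>g'\<in>range flat_exp. \<forall>t. (g has_real_derivative g' t) (at t)" if "g \<in> range flat_exp" for g
      using that flat_exp_DERIV by fast
  qed (simp_all add: u)
  have supp: "norm x < \<epsilon>" if "b x \<noteq> 0" for x
  proof -
    have "(norm x)\<^sup>2 < \<epsilon>\<^sup>2" using that by (auto simp: b_def flat_exp_def u_def split: if_splits)
    then show ?thesis using assms by (simp add: power_less_imp_less_base)
  qed
  have nonneg: "0 \<le> b x" for x by (simp add: b_def flat_exp_def)
  have bs: "bounded {x. b x \<noteq> 0}"
    by (rule bounded_subset[OF bounded_ball[of 0 \<epsilon>]]) (use supp in auto)
  define I where "I = integral UNIV b"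
  have "I \<noteq> 0"
  proof
    assume "I = 0"
    obtain a where a: "{x. b x \<noteq> 0} \<subseteq> box (- a) a"
      using bounded_subset_box_symmetric[OF bs] by blast
    have b0: "b 0 > 0" using assms by (simp add: b_def flat_exp_def u_def)
    have cont: "continuous_on (cbox (- a) a) b"
      by (intro continuous_on_subset[OF C_k_continuous_self[OF b[of 0]]]) simp
    have "(b has_integral 0) (cbox (- a) a)"
    proof -
      have "integral UNIV b = integral (cbox (- a) a) b"
        using a box_subset_cbox by (intro integral_UNIV_eq_cbox) blast
      then show ?thesis
        using \<open>I = 0\<close> integrable_integral[OF integrable_continuous[OF cont]] by (simp add: I_def)
    qed
    moreover have "0 \<in> box (- a) a" using a b0 by auto
    ultimately have "b 0 = 0"
      using has_integral_0_cbox_imp_0[OF cont nonneg] box_subset_cbox by blast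
    with b0 show False by simp
  qed
  moreover have "I \<ge> 0"
    unfolding I_def using nonneg b bs C_k_continuous_self by (intro integral_nonneg integrable_bounded_support) blast+
  ultimately have I: "I > 0" by simp
  show ?thesis
  proof (rule that[of "\<lambda>x. (1 / I) * b x"])
    show "C_k m (\<lambda>x. (1 / I) * b x)" for m by (intro C_k_mult C_k_const b)
    show "integral UNIV (\<lambda>x. (1 / I) * b x) = 1" using I by (simp add: I_def)
  qed (use I nonneg supp in auto)
qed

section \<open>Estimating the norm\<close>

definition mi_word :: "('n::finite \<Rightarrow> nat) \<Rightarrow> 'n list" where
  "mi_word \<alpha> = concat (map (\<lambda>i. replicate (\<alpha> i) i) coords)"

lemma mderiv_pderivs: "mderiv \<alpha> = pderivs (mi_word \<alpha>)"
  by (simp add: mderiv_def mi_word_def)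

lemma length_mi_word_eq: "length (mi_word \<alpha>) = mi_order \<alpha>"
  unfolding mi_word_def by (rule length_mi_word)

lemma continuous_on_mderiv: "C_k k f \<Longrightarrow> mi_order \<alpha> \<le> k \<Longrightarrow> continuous_on UNIV (mderiv \<alpha> f)"
  unfolding mderiv_pderivs by (rule C_k_continuous) (simp_all add: length_mi_word_eq)

lemma finite_mi_order_le: "finite {\<alpha> :: 'n::finite \<Rightarrow> nat. mi_order \<alpha> \<le> k}"
proof (rule finite_subset)
  have "\<alpha> i \<le> mi_order \<alpha>" for \<alpha> :: "'n \<Rightarrow> nat" and i
    unfolding mi_order_def by (rule member_le_sum) simp_all
  then show "{\<alpha> :: 'n \<Rightarrow> nat. mi_order \<alpha> \<le> k} \<subseteq>
      {f. \<forall>x. (x \<in> UNIV \<longrightarrow> f x \<in> {..k}) \<and> (x \<notin> UNIV \<longrightarrow> f x = 0)}"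
    by (simp add: Collect_mono_iff) (meson order_trans)
qed (intro finite_set_of_finite_funs finite_class.finite_UNIV finite_atMost)

lemma modulus_pos: "modulus_of_continuity \<omega> \<Longrightarrow> 0 < t \<Longrightarrow> 0 < \<omega> t"
  by (simp add: modulus_of_continuity_def)

text \<open>Two points at distance at least \<open>\<delta>\<close> contribute at most \<open>2 * s / \<omega> \<delta>\<close> to the seminorm, so
  only the local oscillation of the top derivatives has to be compared with \<open>\<omega>\<close>.\<close>

lemma Cb_enorm_le_local:
  fixes u :: "real^'n::finite \<Rightarrow> real"
  assumes w: "modulus_of_continuity \<omega>" and u: "C_k k u" and \<delta>: "0 < \<delta>" and \<eta>: "0 \<le> \<eta>"
    and sup: "\<And>\<alpha> x. mi_order \<alpha> \<le> k \<Longrightarrow> \<bar>mderiv \<alpha> u x\<bar> \<le> s"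
    and s: "s \<le> \<eta>" "2 * s \<le> \<eta> * \<omega> \<delta>"
    and osc: "\<And>\<alpha> x y. mi_order \<alpha> = k \<Longrightarrow> x \<noteq> y \<Longrightarrow> norm (x - y) < \<delta> \<Longrightarrow>
      \<bar>mderiv \<alpha> u x - mderiv \<alpha> u y\<bar> \<le> \<eta> * \<omega> (norm (x - y))"
  shows "Cb_enorm k \<omega> u \<le> ennreal \<eta>"
  unfolding Cb_enorm_le_iff[OF u]
proof (intro conjI allI impI ennreal_leI)
  show "\<bar>mderiv \<alpha> u x\<bar> \<le> \<eta>" if "mi_order \<alpha> \<le> k" for \<alpha> x
    using sup[OF that] s(1) by (rule order_trans)
  show "\<bar>mderiv \<alpha> u x - mderiv \<alpha> u y\<bar> / \<omega> (norm (x - y)) \<le> \<eta>"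
    if a: "mi_order \<alpha> = k" and xy: "y \<noteq> x" for \<alpha> x y
  proof -
    have pos: "0 < \<omega> (norm (x - y))" using xy by (intro modulus_pos[OF w]) auto
    have "\<bar>mderiv \<alpha> u x - mderiv \<alpha> u y\<bar> \<le> \<eta> * \<omega> (norm (x - y))"
    proof (cases "norm (x - y) < \<delta>")
      case True
      then show ?thesis by (rule osc[OF a xy[symmetric]])
    next
      case False
      have "mono_on {0<..} \<omega>" using w by (simp add: modulus_of_continuity_def)
      then have "\<omega> \<delta> \<le> \<omega> (norm (x - y))"
        by (rule mono_onD) (use False \<delta> in auto)
      then have "\<eta> * \<omega> \<delta> \<le> \<eta> * \<omega> (norm (x - y))" using \<eta> by (rule mult_left_mono)
      moreover have "\<bar>mderiv \<alpha> u x - mderiv \<alpha> u y\<bar> \<le> 2 * s"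
        using sup[of \<alpha> x] sup[of \<alpha> y] a by linarith
      ultimately show ?thesis using s(2) by linarith
    qed
    then show ?thesis using pos by (simp add: divide_le_eq)
  qed
qed

text \<open>Monotonicity of \<open>t / \<omega> t\<close>, evaluated at \<open>t\<close> and \<open>1\<close>.\<close>

lemma modulus_linear_lower:
  assumes w: "modulus_of_continuity \<omega>" and t: "0 < t" "t \<le> 1"
  shows "t * \<omega> 1 \<le> \<omega> t"
proof -
  have "mono_on {0<..} (\<lambda>t. t / \<omega> t)" using w by (simp add: modulus_of_continuity_def)
  then have "t / \<omega> t \<le> 1 / \<omega> 1" using t by (auto dest: mono_onD[of _ _ t 1])
  then show ?thesis using modulus_pos[OF w, of t] modulus_pos[OF w, of 1] t
    by (simp add: field_simps)
qed

lemma mderiv_lipschitz: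
  fixes u :: "real^'n::finite \<Rightarrow> real"
  assumes u: "C_k (Suc k) u" and s: "\<And>w x. length w \<le> Suc k \<Longrightarrow> \<bar>pderivs w u x\<bar> \<le> s"
    and a: "mi_order \<alpha> \<le> k"
  shows "\<bar>mderiv \<alpha> u x - mderiv \<alpha> u y\<bar> \<le> real CARD('n) * s * norm (x - y)"
  unfolding mderiv_pderivs
proof (rule lipschitz_of_partials)
  fix i x
  show "has_partial (pderivs (mi_word \<alpha>) u) i x (pderivs (i # mi_word \<alpha>) u x)"
    by (rule C_k_has_partial[OF u]) (simp add: length_mi_word_eq a less_Suc_eq_le)
  show "\<bar>pderivs (i # mi_word \<alpha>) u x\<bar> \<le> s"
    by (rule s) (simp add: length_mi_word_eq a)
qed

text \<open>One derivative more than \<open>k\<close> makes the top derivatives Lipschitz, and near zero \<open>\<omega>\<close> is at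
  least linear: this is the embedding of \<open>C\<^sup>k\<^sup>+\<^sup>1\<close> with its sup norm into \<open>C\<^sup>k\<^sup>,\<^sup>\<omega>\<close>.\<close>

lemma Cb_enorm_le_C_Suc:
  fixes u :: "real^'n::finite \<Rightarrow> real"
  assumes w: "modulus_of_continuity \<omega>" and u: "C_k (Suc k) u" and s0: "0 \<le> s"
    and s: "\<And>w x. length w \<le> Suc k \<Longrightarrow> \<bar>pderivs w u x\<bar> \<le> s"
  shows "Cb_enorm k \<omega> u \<le> ennreal ((1 + (2 + real CARD('n)) / \<omega> 1) * s)"
proof (rule Cb_enorm_le_local[OF w C_k_mono[OF u] zero_less_one])
  let ?C = "1 + (2 + real CARD('n)) / \<omega> 1"
  have w1: "0 < \<omega> 1" by (simp add: modulus_pos[OF w])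
  have C: "?C * \<omega> 1 = \<omega> 1 + 2 + real CARD('n)" using w1 by (simp add: field_simps)
  show "k \<le> Suc k" by simp
  show "0 \<le> ?C * s" using w1 s0 by simp
  show "\<bar>mderiv \<alpha> u x\<bar> \<le> s" if "mi_order \<alpha> \<le> k" for \<alpha> x
    unfolding mderiv_pderivs using that by (intro s) (simp add: length_mi_word_eq)
  show "s \<le> ?C * s" using w1 s0 by (simp add: distrib_right)
  have "?C * s * \<omega> 1 = (\<omega> 1 + 2 + real CARD('n)) * s" unfolding C[symmetric] by (simp add: ac_simps)
  then have Cs: "?C * s * \<omega> 1 = \<omega> 1 * s + 2 * s + real CARD('n) * s" by (simp add: distrib_right)
  have nonneg: "0 \<le> \<omega> 1 * s" "0 \<le> real CARD('n) * s" using w1 s0 by simp_all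
  show "2 * s \<le> ?C * s * \<omega> 1" unfolding Cs using nonneg by linarith
  show "\<bar>mderiv \<alpha> u x - mderiv \<alpha> u y\<bar> \<le> ?C * s * \<omega> (norm (x - y))"
    if a: "mi_order \<alpha> = k" and xy: "x \<noteq> y" "norm (x - y) < 1" for \<alpha> x y
  proof -
    have "\<bar>mderiv \<alpha> u x - mderiv \<alpha> u y\<bar> \<le> real CARD('n) * s * norm (x - y)"
      using mderiv_lipschitz[OF u s] a by blast
    also have "\<dots> \<le> ?C * s * \<omega> 1 * norm (x - y)"
      unfolding Cs using nonneg s0 by (intro mult_right_mono) auto
    also have "\<dots> = ?C * s * (norm (x - y) * \<omega> 1)" by (simp add: ac_simps)
    also have "\<dots> \<le> ?C * s * \<omega> (norm (x - y))"
      using xy w1 s0 by (intro mult_left_mono modulus_linear_lower[OF w]) auto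
    finally show ?thesis .
  qed
qed

section \<open>Test functions belong to the space\<close>

lemma bounded_support_bound:
  fixes g :: "real^'n::finite \<Rightarrow> real"
  assumes "continuous_on UNIV g" "bounded {x. g x \<noteq> 0}"
  shows "\<exists>B. \<forall>x. \<bar>g x\<bar> \<le> B"
proof -
  obtain a where a: "\<And>y. y \<notin> cbox (- a) a \<Longrightarrow> g y = 0" using bounded_support_box[OF assms(2)] by blast
  have "compact (g ` cbox (- a) a)"
    by (intro compact_continuous_image continuous_on_subset[OF assms(1)]) auto
  then obtain B where "\<forall>z\<in>g ` cbox (- a) a. norm z \<le> B"
    by (meson compact_imp_bounded bounded_iff)
  then have "\<bar>g x\<bar> \<le> max B 0" for x
    using a[of x] by (cases "x \<in> cbox (- a) a") (auto intro: le_max_iff_disj[THEN iffD2])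
  then show ?thesis by blast
qed

lemma finite_words: "finite {w :: 'n::finite list. length w \<le> k}"
  using finite_lists_length_le[OF finite_class.finite_UNIV, of k] by simp

lemma Cc_infty_pderivs_bound:
  fixes f :: "real^'n::finite \<Rightarrow> real"
  assumes "f \<in> Cc_infty"
  shows "\<exists>s\<ge>0. \<forall>w x. length w \<le> m \<longrightarrow> \<bar>pderivs w f x\<bar> \<le> s"
proof -
  have f: "C_k m f" "bounded {x. f x \<noteq> 0}" using assms by (auto simp: Cc_infty_def)
  have "\<forall>w\<in>{w :: 'n list. length w \<le> m}. \<exists>B. \<forall>x. \<bar>pderivs w f x\<bar> \<le> B"
    using bounded_support_bound[OF C_k_continuous[OF f(1)] bounded_pderivs_support[OF f(2)]] by simp
  then obtain B where B: "\<And>w x. length w \<le> m \<Longrightarrow> \<bar>pderivs w f x\<bar> \<le> B w"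
    unfolding bchoice_iff by auto
  let ?s = "\<Sum>w\<in>{w :: 'n list. length w \<le> m}. B w"
  have B0: "0 \<le> B w" if "length w \<le> m" for w using B[OF that, of 0] by linarith
  have "B w \<le> ?s" if "length w \<le> m" for w
    using that B0 finite_words by (intro member_le_sum) auto
  moreover have "0 \<le> ?s" using B0 by (intro sum_nonneg) auto
  ultimately show ?thesis using B order_trans by blast
qed

text \<open>The top derivatives of a test function are Lipschitz, hence their increments are of order \<open>t\<close>, and
  \<open>t / \<omega> t \<longlongrightarrow> 0\<close> turns this into little-o of \<open>\<omega> t\<close>. If instead \<open>\<omega> t\<close> were comparable with \<open>t\<close>,
  the little-o condition would force the top derivatives to be constant.\<close>

lemma Cc_infty_subset_C0:
  assumes w: "modulus_of_continuity \<omega>" and lim: "((\<lambda>t. t / \<omega> t) \<longlongrightarrow> 0) (at_right 0)"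
  shows "(Cc_infty :: (real^'n::finite \<Rightarrow> real) set) \<subseteq> C0_space k \<omega>"
proof
  fix f :: "real^'n \<Rightarrow> real" assume f: "f \<in> Cc_infty"
  have C: "C_k m f" for m using f by (simp add: Cc_infty_def)
  have b: "bounded {x. f x \<noteq> 0}" using f by (simp add: Cc_infty_def)
  obtain s where s: "0 \<le> s" "\<And>w x. length w \<le> Suc k \<Longrightarrow> \<bar>pderivs w f x\<bar> \<le> s"
    using Cc_infty_pderivs_bound[OF f, of "Suc k"] by blast
  have "Cb_enorm k \<omega> f < \<infinity>"
    using Cb_enorm_le_C_Suc[OF w C s(1) s(2), of k] by (auto simp: top_unique less_top[symmetric])
  moreover have "(mderiv \<alpha> f \<longlongrightarrow> 0) at_infinity" for \<alpha>
  proof (rule tendsto_eventually)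
    obtain r where r: "\<forall>x\<in>{x. mderiv \<alpha> f x \<noteq> 0}. norm x \<le> r"
      using bounded_pderivs_support[OF b, of "mi_word \<alpha>"] unfolding mderiv_pderivs bounded_iff by blast
    show "\<forall>\<^sub>F x in at_infinity. mderiv \<alpha> f x = 0"
      unfolding eventually_at_infinity by (rule exI[of _ "r + 1"]) (use r in force)
  qed
  moreover have "\<exists>\<delta>>0. \<forall>x y. x \<noteq> y \<and> norm (x - y) < \<delta> \<longrightarrow>
      \<bar>(mderiv \<alpha> f x - mderiv \<alpha> f y) / \<omega> (norm (x - y))\<bar> < \<epsilon>"
    if a: "mi_order \<alpha> = k" and e: "0 < \<epsilon>" for \<alpha> \<epsilon>
  proof -
    let ?L = "real CARD('n) * s + 1"
    have L: "0 < ?L" using s(1) by (simp add: add_nonneg_pos)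
    have "\<forall>\<^sub>F t in at_right 0. t / \<omega> t < \<epsilon> / ?L"
      using order_tendstoD(2)[OF lim, of "\<epsilon> / ?L"] e L by simp
    then obtain \<delta> where \<delta>: "\<delta> > 0" "\<And>t. 0 < t \<Longrightarrow> t < \<delta> \<Longrightarrow> t / \<omega> t < \<epsilon> / ?L"
      unfolding eventually_at_right_field by auto
    show ?thesis
    proof (intro exI[of _ \<delta>] conjI allI impI \<open>\<delta> > 0\<close>)
      fix x y :: "real^'n" assume xy: "x \<noteq> y \<and> norm (x - y) < \<delta>"
      let ?t = "norm (x - y)"
      have t: "0 < ?t" using xy by simp
      note pos = modulus_pos[OF w t]
      have "\<bar>mderiv \<alpha> f x - mderiv \<alpha> f y\<bar> \<le> real CARD('n) * s * ?t"
        using mderiv_lipschitz[OF C s(2)] a by blast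
      also have "\<dots> \<le> ?L * ?t" using t by (intro mult_right_mono) auto
      finally have "\<bar>mderiv \<alpha> f x - mderiv \<alpha> f y\<bar> / \<omega> ?t \<le> ?L * (?t / \<omega> ?t)"
        using pos by (simp add: divide_right_mono)
      also have "\<dots> < \<epsilon>" using \<delta>(2)[OF t] xy L by (simp add: field_simps)
      finally show "\<bar>(mderiv \<alpha> f x - mderiv \<alpha> f y) / \<omega> ?t\<bar> < \<epsilon>" using pos by simp
    qed
  qed
  ultimately show "f \<in> C0_space k \<omega>" using C unfolding C0_space_def Cb_space_def by blast
qed

section \<open>Uniformity over the finitely many derivatives\<close>

lemma finite_uniform_radius:
  assumes "finite A" and "\<And>a. a \<in> A \<Longrightarrow> \<exists>d>0. P a d"
    and mono: "\<And>a d d'. P a d \<Longrightarrow> 0 < d' \<Longrightarrow> d' \<le> d \<Longrightarrow> P a d'"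
  shows "\<exists>d>(0::real). \<forall>a\<in>A. P a d"
  using assms(1,2)
proof (induction A)
  case (insert a A)
  obtain d1 where "d1 > 0" "P a d1" using insert.prems by blast
  moreover obtain d2 where "d2 > 0" "\<forall>a\<in>A. P a d2" using insert by blast
  ultimately show ?case by (intro exI[of _ "min d1 d2"]) (auto intro: mono)
qed (auto intro: exI[of _ 1])

lemma C0_space_C_k: "f \<in> C0_space k \<omega> \<Longrightarrow> C_k k f"
  by (simp add: C0_space_def Cb_space_def)

text \<open>The spaces prescribe smallness for one multi-index at a time; there are finitely many multi-indices
  of order at most \<open>k\<close>, so one radius serves all of them.\<close>

lemma C0_uniform_oscillation:
  fixes f :: "real^'n::finite \<Rightarrow> real"
  assumes w: "modulus_of_continuity \<omega>" and f: "f \<in> C0_space k \<omega>" and e: "0 < \<epsilon>"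
  shows "\<exists>\<delta>>0. \<forall>\<alpha> x y. mi_order \<alpha> = k \<longrightarrow> x \<noteq> y \<longrightarrow> norm (x - y) < \<delta> \<longrightarrow>
    \<bar>mderiv \<alpha> f x - mderiv \<alpha> f y\<bar> \<le> \<epsilon> * \<omega> (norm (x - y))"
proof -
  have "\<exists>d>0. \<forall>\<alpha>\<in>{\<alpha> :: 'n \<Rightarrow> nat. mi_order \<alpha> = k}. \<forall>x y. x \<noteq> y \<longrightarrow> norm (x - y) < d \<longrightarrow>
      \<bar>mderiv \<alpha> f x - mderiv \<alpha> f y\<bar> \<le> \<epsilon> * \<omega> (norm (x - y))"
  proof (rule finite_uniform_radius)
    show "finite {\<alpha> :: 'n \<Rightarrow> nat. mi_order \<alpha> = k}"
      by (rule finite_subset[OF _ finite_mi_order_le[of k]]) auto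
    fix \<alpha> :: "'n \<Rightarrow> nat" assume a: "\<alpha> \<in> {\<alpha>. mi_order \<alpha> = k}"
    with f have "\<forall>\<epsilon>>0. \<exists>\<delta>>0. \<forall>x y. x \<noteq> y \<and> norm (x - y) < \<delta> \<longrightarrow>
        \<bar>(mderiv \<alpha> f x - mderiv \<alpha> f y) / \<omega> (norm (x - y))\<bar> < \<epsilon>"
      by (simp add: C0_space_def)
    with e obtain d where d: "d > 0" "\<And>x y. x \<noteq> y \<Longrightarrow> norm (x - y) < d \<Longrightarrow>
        \<bar>(mderiv \<alpha> f x - mderiv \<alpha> f y) / \<omega> (norm (x - y))\<bar> < \<epsilon>"
      by meson
    have "\<bar>mderiv \<alpha> f x - mderiv \<alpha> f y\<bar> \<le> \<epsilon> * \<omega> (norm (x - y))" if xy: "x \<noteq> y" "norm (x - y) < d" for x y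
    proof -
      have "0 < \<omega> (norm (x - y))" using xy by (intro modulus_pos[OF w]) simp
      then show ?thesis using d(2)[OF xy] by (simp add: pos_divide_less_eq)
    qed
    with d(1) show "\<exists>d>0. \<forall>x y. x \<noteq> y \<longrightarrow> norm (x - y) < d \<longrightarrow>
        \<bar>mderiv \<alpha> f x - mderiv \<alpha> f y\<bar> \<le> \<epsilon> * \<omega> (norm (x - y))" by blast
  qed auto
  then show ?thesis by simp
qed

lemma C0_uniform_vanishing:
  fixes f :: "real^'n::finite \<Rightarrow> real"
  assumes f: "f \<in> C0_space k \<omega>" and e: "0 < \<epsilon>"
  shows "\<exists>R>0. \<forall>\<alpha> x. mi_order \<alpha> \<le> k \<longrightarrow> R \<le> norm x \<longrightarrow> \<bar>mderiv \<alpha> f x\<bar> \<le> \<epsilon>"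
proof -
  \<comment> \<open>Radii have to grow here, whereas the uniformity lemma shrinks them: it is applied to \<open>1 / R\<close>.\<close>
  have "\<exists>d>0. \<forall>\<alpha>\<in>{\<alpha> :: 'n \<Rightarrow> nat. mi_order \<alpha> \<le> k}. \<forall>x. 1 / d \<le> norm x \<longrightarrow> \<bar>mderiv \<alpha> f x\<bar> \<le> \<epsilon>"
  proof (rule finite_uniform_radius[OF finite_mi_order_le])
    fix \<alpha> :: "'n \<Rightarrow> nat" assume "\<alpha> \<in> {\<alpha>. mi_order \<alpha> \<le> k}"
    then have "(mderiv \<alpha> f \<longlongrightarrow> 0) at_infinity" using f by (auto simp: C0_space_def)
    then have "\<forall>\<^sub>F x in at_infinity. dist (mderiv \<alpha> f x) 0 < \<epsilon>" using e by (rule tendstoD)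
    then obtain b where b: "0 < b" "\<And>x. b \<le> norm x \<Longrightarrow> \<bar>mderiv \<alpha> f x\<bar> < \<epsilon>"
      unfolding eventually_at_infinity_pos by auto
    then show "\<exists>d>0. \<forall>x. 1 / d \<le> norm x \<longrightarrow> \<bar>mderiv \<alpha> f x\<bar> \<le> \<epsilon>"
      by (intro exI[of _ "1 / b"]) (auto intro: less_imp_le)
  next
    fix \<alpha> :: "'n \<Rightarrow> nat" and d d' :: real
    assume P: "\<forall>x. 1 / d \<le> norm x \<longrightarrow> \<bar>mderiv \<alpha> f x\<bar> \<le> \<epsilon>" and d: "0 < d'" "d' \<le> d"
    have "1 / d \<le> 1 / d'" using d by (simp add: frac_le)
    then show "\<forall>x. 1 / d' \<le> norm x \<longrightarrow> \<bar>mderiv \<alpha> f x\<bar> \<le> \<epsilon>" using P order_trans by blast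
  qed
  then obtain d where "0 < d" "\<forall>\<alpha> x. mi_order \<alpha> \<le> k \<longrightarrow> 1 / d \<le> norm x \<longrightarrow> \<bar>mderiv \<alpha> f x\<bar> \<le> \<epsilon>" by auto
  then show ?thesis by (intro exI[of _ "1 / d"]) simp
qed

text \<open>Far out both values are small, and elsewhere both points lie in a compact ball.\<close>

lemma C0_uniform_continuity:
  fixes f :: "real^'n::finite \<Rightarrow> real"
  assumes f: "f \<in> C0_space k \<omega>" and e: "0 < \<epsilon>"
  shows "\<exists>d>0. \<forall>\<alpha> x y. mi_order \<alpha> \<le> k \<longrightarrow> norm (x - y) < d \<longrightarrow> \<bar>mderiv \<alpha> f x - mderiv \<alpha> f y\<bar> \<le> \<epsilon>"
proof -
  obtain R where R: "0 < R" "\<And>\<alpha> x. mi_order \<alpha> \<le> k \<Longrightarrow> R \<le> norm x \<Longrightarrow> \<bar>mderiv \<alpha> f x\<bar> \<le> \<epsilon> / 2"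
    using C0_uniform_vanishing[OF f half_gt_zero[OF e]] by blast
  have "\<exists>d>0. \<forall>\<alpha>\<in>{\<alpha> :: 'n \<Rightarrow> nat. mi_order \<alpha> \<le> k}. \<forall>x y. norm (x - y) < d \<longrightarrow> \<bar>mderiv \<alpha> f x - mderiv \<alpha> f y\<bar> \<le> \<epsilon>"
  proof (rule finite_uniform_radius[OF finite_mi_order_le])
    fix \<alpha> :: "'n \<Rightarrow> nat" assume "\<alpha> \<in> {\<alpha>. mi_order \<alpha> \<le> k}"
    then have a: "mi_order \<alpha> \<le> k" by simp
    have "uniformly_continuous_on (cball 0 (R + 1)) (mderiv \<alpha> f)"
      using continuous_on_mderiv[OF C0_space_C_k[OF f] a]
      by (intro compact_uniformly_continuous compact_cball) (rule continuous_on_subset, auto)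
    then obtain d where d: "d > 0" "\<And>x y. x \<in> cball 0 (R + 1) \<Longrightarrow> y \<in> cball 0 (R + 1) \<Longrightarrow> dist y x < d \<Longrightarrow>
        dist (mderiv \<alpha> f y) (mderiv \<alpha> f x) < \<epsilon>"
      using e unfolding uniformly_continuous_on_def by meson
    have "\<bar>mderiv \<alpha> f x - mderiv \<alpha> f y\<bar> \<le> \<epsilon>" if xy: "norm (x - y) < min d 1" for x y
    proof (cases "R \<le> norm x \<and> R \<le> norm y")
      case True
      then show ?thesis using R(2)[OF a, of x] R(2)[OF a, of y] by linarith
    next
      case False
      have "norm x \<le> norm y + norm (x - y)" "norm y \<le> norm x + norm (x - y)"
        using norm_triangle_sub[of x y] norm_triangle_sub[of y x] by (simp_all add: norm_minus_commute)
      then have "x \<in> cball 0 (R + 1)" "y \<in> cball 0 (R + 1)" using False xy by auto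
      from d(2)[OF this(2,1)] show ?thesis using xy by (simp add: dist_norm)
    qed
    then show "\<exists>d>0. \<forall>x y. norm (x - y) < d \<longrightarrow> \<bar>mderiv \<alpha> f x - mderiv \<alpha> f y\<bar> \<le> \<epsilon>"
      using d(1) by (intro exI[of _ "min d 1"]) simp
  qed auto
  then show ?thesis by simp
qed

section \<open>Density of the test functions\<close>

lemma mderiv_conv:
  fixes \<phi> f :: "real^'n::finite \<Rightarrow> real"
  assumes "continuous_on UNIV \<phi>" "bounded {x. \<phi> x \<noteq> 0}" "C_k k f" "mi_order \<alpha> \<le> k"
  shows "mderiv \<alpha> (conv \<phi> f) = conv \<phi> (mderiv \<alpha> f)"
  unfolding mderiv_pderivs
  by (rule pderivs_conv(1)[OF assms(1,3)]) (simp_all add: assms(2,4) length_mi_word_eq)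

text \<open>Averaging against a probability density at scale \<open>\<epsilon>\<close> moves each derivative by at most its
  oscillation at scale \<open>\<epsilon>\<close>, and does not increase increments: hence the local oscillation of the
  top derivatives of \<open>f - conv \<phi> f\<close> is at most twice that of \<open>f\<close>, whatever \<open>\<epsilon>\<close> is. This is where
  the little-o condition on the top derivatives enters.\<close>

lemma mollification_close:
  fixes f :: "real^'n::finite \<Rightarrow> real"
  assumes w: "modulus_of_continuity \<omega>" and f: "f \<in> C0_space k \<omega>" and \<eta>: "0 < \<eta>"
  obtains \<epsilon> where "0 < \<epsilon>" and
    "\<forall>\<phi>. continuous_on UNIV \<phi> \<and> (\<forall>x. 0 \<le> \<phi> x) \<and> (\<forall>x. \<phi> x \<noteq> 0 \<longrightarrow> norm x < \<epsilon>) \<and> integral UNIV \<phi> = 1 \<longrightarrow>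
      Cb_enorm k \<omega> (\<lambda>x. f x - conv \<phi> f x) \<le> ennreal \<eta>"
proof -
  have C: "C_k k f" by (rule C0_space_C_k[OF f])
  obtain \<delta> where \<delta>: "\<delta> > 0" "\<And>\<alpha> x y. mi_order \<alpha> = k \<Longrightarrow> x \<noteq> y \<Longrightarrow> norm (x - y) < \<delta> \<Longrightarrow>
      \<bar>mderiv \<alpha> f x - mderiv \<alpha> f y\<bar> \<le> \<eta> / 2 * \<omega> (norm (x - y))"
    using C0_uniform_oscillation[OF w f half_gt_zero[OF \<eta>]] by meson
  \<comment> \<open>The largest admissible sup norm of the derivatives in \<open>Cb_enorm_le_local\<close>, once the scale \<open>\<delta>\<close> is fixed.\<close>
  define s where "s = min \<eta> (\<eta> * \<omega> \<delta> / 2)"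
  have s: "0 < s" "s \<le> \<eta>" "2 * s \<le> \<eta> * \<omega> \<delta>"
    using \<eta> modulus_pos[OF w \<delta>(1)] by (auto simp: s_def min_def)
  obtain \<epsilon> where \<epsilon>: "\<epsilon> > 0" "\<And>\<alpha> x y. mi_order \<alpha> \<le> k \<Longrightarrow> norm (x - y) < \<epsilon> \<Longrightarrow>
      \<bar>mderiv \<alpha> f x - mderiv \<alpha> f y\<bar> \<le> s"
    using C0_uniform_continuity[OF f s(1)] by meson
  show ?thesis
  proof (rule that[OF \<epsilon>(1)], intro allI impI)
    fix \<phi> :: "real^'n \<Rightarrow> real"
    assume "continuous_on UNIV \<phi> \<and> (\<forall>x. 0 \<le> \<phi> x) \<and> (\<forall>x. \<phi> x \<noteq> 0 \<longrightarrow> norm x < \<epsilon>) \<and> integral UNIV \<phi> = 1"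
    then have \<phi>: "continuous_on UNIV \<phi>" and nonneg: "\<And>x. 0 \<le> \<phi> x"
      and supp: "\<And>x. \<phi> x \<noteq> 0 \<Longrightarrow> norm x < \<epsilon>" and one: "integral UNIV \<phi> = 1"
      by simp_all
    have b: "bounded {x. \<phi> x \<noteq> 0}"
      by (rule bounded_subset[OF bounded_ball[of 0 \<epsilon>]]) (use supp in auto)
    have abs: "integral UNIV (\<lambda>y. \<bar>\<phi> y\<bar>) = 1" using nonneg one by simp
    have Cc: "C_k k (conv \<phi> f)" using b by (intro C_k_conv \<phi> C) simp
    have md: "mderiv \<alpha> (\<lambda>x. f x - conv \<phi> f x) = (\<lambda>x. mderiv \<alpha> f x - conv \<phi> (mderiv \<alpha> f) x)"
      if a: "mi_order \<alpha> \<le> k" for \<alpha>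
      unfolding mderiv_diff[OF C Cc a] mderiv_conv[OF \<phi> b C a] by (rule refl)
    have average: "\<bar>conv \<phi> g x - conv \<phi> h y\<bar> \<le> c"
      if "continuous_on UNIV g" "continuous_on UNIV h" "\<And>z. norm z < \<epsilon> \<Longrightarrow> \<bar>g (x - z) - h (y - z)\<bar> \<le> c"
      for g h x y c
    proof -
      have "continuous_on UNIV (\<lambda>z. g (x - z) - h (y - z))"
        by (intro continuous_on_diff continuous_on_compose2[OF that(1)] continuous_on_compose2[OF that(2)]
            continuous_on_const continuous_on_id) simp_all
      from kernel_integral_bound[OF \<phi> b this, of c] show ?thesis
        unfolding conv_diff[OF \<phi> b that(1,2)] using that(3) supp abs by simp
    qed
    show "Cb_enorm k \<omega> (\<lambda>x. f x - conv \<phi> f x) \<le> ennreal \<eta>"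
    proof (rule Cb_enorm_le_local[OF w C_k_diff[OF C Cc] \<delta>(1) less_imp_le[OF \<eta>] _ s(2,3)])
      fix \<alpha> :: "'n \<Rightarrow> nat" and x :: "real^'n" assume a: "mi_order \<alpha> \<le> k"
      \<comment> \<open>As the kernel has mass one, \<open>f - conv \<phi> f\<close> is itself a difference of two averages.\<close>
      have const: "conv \<phi> (\<lambda>_. mderiv \<alpha> f x) x = mderiv \<alpha> f x"
        unfolding conv_def using one by simp
      have "\<bar>conv \<phi> (\<lambda>_. mderiv \<alpha> f x) x - conv \<phi> (mderiv \<alpha> f) x\<bar> \<le> s"
        by (intro average continuous_on_const continuous_on_mderiv[OF C a] \<epsilon>(2)[OF a]) simp
      then show "\<bar>mderiv \<alpha> (\<lambda>x. f x - conv \<phi> f x) x\<bar> \<le> s" by (simp only: md[OF a] const)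
    next
      fix \<alpha> :: "'n \<Rightarrow> nat" and x y :: "real^'n"
      assume a: "mi_order \<alpha> = k" and xy: "x \<noteq> y" "norm (x - y) < \<delta>"
      note a' = eq_refl[OF a]
      have "\<bar>mderiv \<alpha> f x - mderiv \<alpha> f y\<bar> \<le> \<eta> / 2 * \<omega> (norm (x - y))" by (rule \<delta>(2)[OF a xy])
      moreover have "\<bar>conv \<phi> (mderiv \<alpha> f) x - conv \<phi> (mderiv \<alpha> f) y\<bar> \<le> \<eta> / 2 * \<omega> (norm (x - y))"
      proof (intro average continuous_on_mderiv[OF C a'])
        fix z show "\<bar>mderiv \<alpha> f (x - z) - mderiv \<alpha> f (y - z)\<bar> \<le> \<eta> / 2 * \<omega> (norm (x - y))"
          using \<delta>(2)[OF a, of "x - z" "y - z"] xy by simp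
      qed
      ultimately show "\<bar>mderiv \<alpha> (\<lambda>x. f x - conv \<phi> f x) x - mderiv \<alpha> (\<lambda>x. f x - conv \<phi> f x) y\<bar>
          \<le> \<eta> * \<omega> (norm (x - y))"
        unfolding md[OF a'] by linarith
    qed
  qed
qed

text \<open>Smoothness comes from the kernel, and the support lies in the sum of the two supports.\<close>

lemma conv_in_Cc_infty:
  fixes f \<phi> :: "real^'n::finite \<Rightarrow> real"
  assumes f: "continuous_on UNIV f" "bounded {x. f x \<noteq> 0}"
    and \<phi>: "\<And>m. C_k m \<phi>" "bounded {x. \<phi> x \<noteq> 0}"
  shows "conv f \<phi> \<in> Cc_infty"
proof -
  obtain A where A: "\<And>x. f x \<noteq> 0 \<Longrightarrow> norm x \<le> A" using f(2) by (auto simp: bounded_iff)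
  obtain B where B: "\<And>x. \<phi> x \<noteq> 0 \<Longrightarrow> norm x \<le> B" using \<phi>(2) by (auto simp: bounded_iff)
  have "norm x \<le> A + B" if "conv f \<phi> x \<noteq> 0" for x
  proof -
    have "\<exists>y. f y * \<phi> (x - y) \<noteq> 0"
    proof (rule ccontr)
      assume "\<not> ?thesis"
      then have "(\<lambda>y. f y * \<phi> (x - y)) = (\<lambda>y. 0)" by (simp add: fun_eq_iff)
      with that show False by (simp add: conv_def)
    qed
    then obtain y where "f y \<noteq> 0" "\<phi> (x - y) \<noteq> 0" by auto
    then show ?thesis using A[of y] B[of "x - y"] norm_triangle_sub[of x y] by linarith
  qed
  then have "bounded {x. conv f \<phi> x \<noteq> 0}" by (auto simp: bounded_iff)
  moreover have "C_k m (conv f \<phi>)" for m using \<phi> f by (intro C_k_conv) auto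
  ultimately show ?thesis by (simp add: Cc_infty_def)
qed

text \<open>A mollified function is approximated by mollifying a continuous truncation of the original
  function. Since all derivatives can be put on the kernel, the error is controlled in every
  \<open>C\<^sup>m\<close> norm by the sup norm of the part cut off; no derivative of the cutoff is ever taken.\<close>

lemma truncation_close:
  fixes f \<phi> :: "real^'n::finite \<Rightarrow> real"
  assumes w: "modulus_of_continuity \<omega>" and f: "continuous_on UNIV f" "(f \<longlongrightarrow> 0) at_infinity"
    and \<phi>: "\<And>m. C_k m \<phi>" "bounded {x. \<phi> x \<noteq> 0}" and \<eta>: "0 < \<eta>"
  obtains h where "h \<in> Cc_infty" "Cb_enorm k \<omega> (\<lambda>x. conv \<phi> f x - h x) \<le> ennreal \<eta>"
proof -
  have \<phi>c: "continuous_on UNIV \<phi>" using \<phi>(1) by (rule C_k_continuous_self)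
  \<comment> \<open>A bound for the integral norms of all derivatives of the kernel that can occur; the summand \<open>1\<close>
    in \<open>K\<close> only keeps \<open>K\<close> positive.\<close>
  define M where "M = (\<Sum>w\<in>{w :: 'n list. length w \<le> Suc k}. integral UNIV (\<lambda>y. \<bar>pderivs w \<phi> y\<bar>))"
  have int: "(\<lambda>y. \<bar>pderivs w \<phi> y\<bar>) integrable_on UNIV" for w
    using bounded_pderivs_support[OF \<phi>(2), of w] C_k_continuous[OF \<phi>(1) order_refl, of w]
    by (intro integrable_bounded_support continuous_on_rabs) simp_all
  have I0: "0 \<le> integral UNIV (\<lambda>y. \<bar>pderivs w \<phi> y\<bar>)" for w
    by (intro integral_nonneg int) simp
  have M: "integral UNIV (\<lambda>y. \<bar>pderivs w \<phi> y\<bar>) \<le> M" if "length w \<le> Suc k" for w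
    unfolding M_def using that finite_words I0 by (intro member_le_sum) simp_all
  have M0: "0 \<le> M" unfolding M_def by (intro sum_nonneg I0)
  define K where "K = (1 + (2 + real CARD('n)) / \<omega> 1) * M + 1"
  have K: "0 < K" using modulus_pos[OF w, of 1] M0 by (simp add: K_def add_nonneg_pos)
  define s where "s = \<eta> / K"
  have s: "0 < s" using \<eta> K by (simp add: s_def)
  obtain R where R: "\<And>x. R \<le> norm x \<Longrightarrow> \<bar>f x\<bar> < s"
    using tendstoD[OF f(2) s] unfolding eventually_at_infinity by auto
  \<comment> \<open>A continuous cutoff, equal to \<open>1\<close> on the ball of radius \<open>R\<close>, where \<open>f\<close> need not be small.\<close>
  define c :: "real^'n \<Rightarrow> real" where "c x = min 1 (max 0 (R + 1 - norm x))" for x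
  have c: "continuous_on UNIV c" unfolding c_def by (intro continuous_intros)
  define v where "v x = (1 - c x) * f x" for x
  have vc: "continuous_on UNIV v" and cf: "continuous_on UNIV (\<lambda>x. c x * f x)"
    unfolding v_def by (intro continuous_intros c f(1))+
  have v: "\<bar>v x\<bar> \<le> s" for x
  proof (cases "norm x \<le> R")
    case True
    then have "v x = 0" by (simp add: v_def c_def)
    then show ?thesis using s by simp
  next
    case False
    then have "\<bar>f x\<bar> \<le> s" using R[of x] by simp
    moreover have "\<bar>1 - c x\<bar> \<le> 1" by (simp add: c_def min_def max_def)
    ultimately have "\<bar>1 - c x\<bar> * \<bar>f x\<bar> \<le> 1 * s" by (intro mult_mono) auto
    then show ?thesis by (simp add: v_def abs_mult)
  qed
  have cfb: "bounded {x. c x * f x \<noteq> 0}"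
    by (rule bounded_subset[OF bounded_cball[of 0 "R + 1"]]) (auto simp: c_def)
  have eq: "(\<lambda>x. conv \<phi> f x - conv (\<lambda>x. c x * f x) \<phi> x) = conv v \<phi>"
  proof
    fix x
    have "conv \<phi> f x - conv (\<lambda>x. c x * f x) \<phi> x = conv \<phi> f x - conv \<phi> (\<lambda>x. c x * f x) x"
      by (simp add: conv_commute[OF \<phi>c \<phi>(2) cf])
    also have "\<dots> = integral UNIV (\<lambda>z. \<phi> z * v (x - z))"
      unfolding conv_diff[OF \<phi>c \<phi>(2) f(1) cf] by (simp add: v_def algebra_simps)
    also have "\<dots> = conv v \<phi> x"
      unfolding conv_commute[OF \<phi>c \<phi>(2) vc, symmetric] conv_def by (rule refl)
    finally show "conv \<phi> f x - conv (\<lambda>x. c x * f x) \<phi> x = conv v \<phi> x" .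
  qed
  show ?thesis
  proof (rule that)
    show "conv (\<lambda>x. c x * f x) \<phi> \<in> Cc_infty" by (rule conv_in_Cc_infty[OF cf cfb \<phi>])
    have "Cb_enorm k \<omega> (conv v \<phi>) \<le> ennreal ((1 + (2 + real CARD('n)) / \<omega> 1) * (s * M))"
    proof (rule Cb_enorm_le_C_Suc[OF w])
      show "C_k (Suc k) (conv v \<phi>)" using \<phi> by (intro C_k_conv vc) simp_all
      show "0 \<le> s * M" using s M0 by simp
      fix w :: "'n list" and x assume lw: "length w \<le> Suc k"
      have pc: "continuous_on UNIV (pderivs w \<phi>)" by (rule C_k_continuous[OF \<phi>(1) order_refl])
      have pb: "bounded {x. pderivs w \<phi> x \<noteq> 0}" by (rule bounded_pderivs_support[OF \<phi>(2)])
      have "pderivs w (conv v \<phi>) x = conv v (pderivs w \<phi>) x"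
        by (subst pderivs_conv(1)[OF vc \<phi>(1) _ lw]) (simp_all add: \<phi>(2))
      also have "\<dots> = conv (pderivs w \<phi>) v x"
        by (simp add: conv_commute[OF pc pb vc])
      finally have "\<bar>pderivs w (conv v \<phi>) x\<bar> \<le> s * integral UNIV (\<lambda>y. \<bar>pderivs w \<phi> y\<bar>)"
        unfolding conv_def using v
        by (simp only:) (intro kernel_integral_bound pc pb continuous_on_compose2[OF vc] continuous_intros; simp)
      also have "\<dots> \<le> s * M" using M[OF lw] s by (intro mult_left_mono) auto
      finally show "\<bar>pderivs w (conv v \<phi>) x\<bar> \<le> s * M" .
    qed
    also have "\<dots> \<le> ennreal \<eta>"
    proof (rule ennreal_leI)
      have "(1 + (2 + real CARD('n)) / \<omega> 1) * (s * M) = s * (K - 1)" by (simp add: K_def)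
      also have "\<dots> \<le> s * K" using s by simp
      also have "\<dots> = \<eta>" using K by (simp add: s_def)
      finally show "(1 + (2 + real CARD('n)) / \<omega> 1) * (s * M) \<le> \<eta>" .
    qed
    finally show "Cb_enorm k \<omega> (\<lambda>x. conv \<phi> f x - conv (\<lambda>x. c x * f x) \<phi> x) \<le> ennreal \<eta>"
      unfolding eq .
  qed
qed

lemma mderiv_zero_index: "mderiv (\<lambda>_. 0) f = f"
proof -
  have "length (mi_word (\<lambda>_::'a. 0)) = 0" by (simp add: length_mi_word_eq mi_order_def)
  then show ?thesis by (simp add: mderiv_pderivs)
qed

text \<open>The mollifier is fixed before truncating, so the large norms of its derivatives are constants when
  the truncation radius is chosen.\<close>

lemma Cc_infty_approx:
  fixes f :: "real^'n::finite \<Rightarrow> real"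
  assumes w: "modulus_of_continuity \<omega>" and f: "f \<in> C0_space k \<omega>" and r: "0 < r"
  obtains h where "h \<in> Cc_infty" "Cb_norm k \<omega> (\<lambda>x. f x - h x) < r"
proof -
  have C: "C_k k f" by (rule C0_space_C_k[OF f])
  have lim: "(f \<longlongrightarrow> 0) at_infinity"
    using f mderiv_zero_index[of f] by (auto simp: C0_space_def mi_order_def dest: spec[of _ "\<lambda>_. 0"])
  have r3: "0 < r / 3" using r by simp
  obtain \<epsilon> where \<epsilon>: "0 < \<epsilon>"
      "\<forall>\<phi>. continuous_on UNIV \<phi> \<and> (\<forall>x. 0 \<le> \<phi> x) \<and> (\<forall>x. \<phi> x \<noteq> 0 \<longrightarrow> norm x < \<epsilon>) \<and> integral UNIV \<phi> = 1 \<longrightarrow>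
        Cb_enorm k \<omega> (\<lambda>x. f x - conv \<phi> f x) \<le> ennreal (r / 3)"
    by (rule mollification_close[OF w f r3])
  obtain \<phi> :: "real^'n \<Rightarrow> real" where \<phi>: "\<And>m. C_k m \<phi>" "\<And>x. 0 \<le> \<phi> x"
      "\<And>x. \<phi> x \<noteq> 0 \<Longrightarrow> norm x < \<epsilon>" "integral UNIV \<phi> = 1"
    by (rule exists_mollifier[OF \<epsilon>(1)]) blast
  have b: "bounded {x. \<phi> x \<noteq> 0}"
    by (rule bounded_subset[OF bounded_ball[of 0 \<epsilon>]]) (use \<phi>(3) in auto)
  have \<phi>c: "continuous_on UNIV \<phi>" using \<phi>(1) by (rule C_k_continuous_self)
  obtain h where h: "h \<in> Cc_infty" "Cb_enorm k \<omega> (\<lambda>x. conv \<phi> f x - h x) \<le> ennreal (r / 3)"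
    by (rule truncation_close[OF w C_k_continuous_self[OF C] lim \<phi>(1) b r3])
  have close: "Cb_enorm k \<omega> (\<lambda>x. f x - conv \<phi> f x) \<le> ennreal (r / 3)"
    using \<epsilon>(2) \<phi>c \<phi>(2-4) by simp
  have Cc: "C_k k (conv \<phi> f)" using b by (intro C_k_conv \<phi>c C) simp
  have Ch: "C_k k h" using h(1) by (simp add: Cc_infty_def)
  have "Cb_enorm k \<omega> (\<lambda>x. f x - h x)
      = Cb_enorm k \<omega> (\<lambda>x. (f x - conv \<phi> f x) - (h x - conv \<phi> f x))" by simp
  also have "\<dots> \<le> Cb_enorm k \<omega> (\<lambda>x. f x - conv \<phi> f x) + Cb_enorm k \<omega> (\<lambda>x. h x - conv \<phi> f x)"
    by (intro Cb_enorm_diff C_k_diff C Cc Ch w)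
  also have "\<dots> \<le> ennreal (r / 3) + ennreal (r / 3)"
    unfolding Cb_enorm_minus[OF w, where g = h]
    by (rule add_mono[OF close h(2)])
  also have "\<dots> = ennreal (2 * r / 3)" using r by (subst ennreal_plus[symmetric]) auto
  finally have "Cb_norm k \<omega> (\<lambda>x. f x - h x) \<le> 2 * r / 3"
    unfolding Cb_norm_def using r by (intro enn2real_leI) auto
  with r have "Cb_norm k \<omega> (\<lambda>x. f x - h x) < r" by simp
  with h(1) show ?thesis by (rule that)
qed

section \<open>Separability\<close>

text \<open>One point for each code that occurs, at each of the scales \<open>1 / (n + 1)\<close>, gives a countable
  dense set.\<close>

lemma (in Metric_space) separable_space_of_codes:
  assumes "\<And>e. 0 < e \<Longrightarrow> \<exists>c :: 'a \<Rightarrow> 'b::countable. \<forall>x\<in>M. \<forall>y\<in>M. c x = c y \<longrightarrow> d x y < e"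
  shows "separable_space mtopology"
proof -
  have "\<forall>n. \<exists>c :: 'a \<Rightarrow> 'b. \<forall>x\<in>M. \<forall>y\<in>M. c x = c y \<longrightarrow> d x y < inverse (Suc n)"
    using assms by simp
  then obtain c :: "nat \<Rightarrow> 'a \<Rightarrow> 'b" where
      c: "\<And>n x y. x \<in> M \<Longrightarrow> y \<in> M \<Longrightarrow> c n x = c n y \<Longrightarrow> d x y < inverse (Suc n)"
    unfolding choice_iff by blast
  \<comment> \<open>For a code that no point carries, \<open>rep\<close> may lie outside the space, hence the intersection
    with \<open>M\<close> in \<open>D\<close>.\<close>
  define rep where "rep n b = (SOME x. x \<in> M \<and> c n x = b)" for n b
  have rep: "rep n (c n x) \<in> M \<and> c n (rep n (c n x)) = c n x" if "x \<in> M" for n x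
    unfolding rep_def by (rule someI[of _ x]) (simp add: that)
  define D where "D = range (\<lambda>(n, b). rep n b) \<inter> M"
  show ?thesis
    unfolding separable_space_def
  proof (intro exI[of _ D] conjI)
    show "countable D" unfolding D_def by (rule countable_Int1) simp
    show "D \<subseteq> topspace mtopology" by (simp add: D_def)
    show "mtopology closure_of D = topspace mtopology"
      unfolding metric_closure_of topspace_mtopology
    proof (intro equalityI subsetI CollectI conjI allI impI)
      fix x and r :: real assume x: "x \<in> M" and r: "0 < r"
      obtain n where n: "inverse (Suc n) < r" using reals_Archimedean[OF r] by blast
      have "d x (rep n (c n x)) < inverse (Suc n)" using rep[OF x, of n] x by (intro c) simp_all
      moreover have "rep n (c n x) \<in> D" using rep[OF x, of n] by (auto simp: D_def)
      ultimately show "\<exists>y\<in>D. y \<in> mball x r"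
        using n x rep[OF x, of n] by (intro bexI[of _ "rep n (c n x)"]) auto
    qed auto
  qed
qed

text \<open>A function is encoded by scales at which its top derivatives have small oscillation, its
  derivatives are small at infinity and vary little, together with the rounded values of the
  derivatives on a finite net that depends on these scales only.\<close>

lemma C0_space_codes:
  fixes k :: nat and \<omega> :: "real \<Rightarrow> real"
  assumes w: "modulus_of_continuity \<omega>" and e: "0 < e"
  shows "\<exists>c :: (real^'n::finite \<Rightarrow> real) \<Rightarrow> (nat \<times> nat \<times> nat) \<times> int list.
    \<forall>f\<in>C0_space k \<omega>. \<forall>g\<in>C0_space k \<omega>. c f = c g \<longrightarrow> Cb_norm k \<omega> (\<lambda>x. f x - g x) < e"
proof -
  define \<eta> where "\<eta> = e / 2"
  have \<eta>: "0 < \<eta>" "\<eta> < e" using e by (simp_all add: \<eta>_def)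
  \<comment> \<open>Once the oscillation scale \<open>1 / (a + 1)\<close> is fixed, \<open>Cb_enorm_le_local\<close> requires the derivatives of
    the difference to be at most \<open>s a\<close>. Passing from \<open>x\<close> to a net point, from \<open>f\<close> to \<open>g\<close> there, and
    back to \<open>x\<close> takes three steps, hence the quarters below.\<close>
  define s where "s a = min \<eta> (\<eta> * \<omega> (inverse (Suc a)) / 2)" for a :: nat
  have s: "0 < s a" "s a \<le> \<eta>" "2 * s a \<le> \<eta> * \<omega> (inverse (Suc a))" for a
    using \<eta>(1) modulus_pos[OF w, of "inverse (Suc a)"] by (auto simp: s_def min_def)
  define good :: "nat \<times> nat \<times> nat \<Rightarrow> (real^'n \<Rightarrow> real) \<Rightarrow> bool" where
    "good = (\<lambda>(a, R, m) f.
      (\<forall>\<alpha> x y. mi_order \<alpha> = k \<longrightarrow> x \<noteq> y \<longrightarrow> norm (x - y) < inverse (Suc a) \<longrightarrow>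
        \<bar>mderiv \<alpha> f x - mderiv \<alpha> f y\<bar> \<le> \<eta> / 2 * \<omega> (norm (x - y))) \<and>
      (\<forall>\<alpha> x. mi_order \<alpha> \<le> k \<longrightarrow> real R \<le> norm x \<longrightarrow> \<bar>mderiv \<alpha> f x\<bar> \<le> s a / 4) \<and>
      (\<forall>\<alpha> x y. mi_order \<alpha> \<le> k \<longrightarrow> norm (x - y) < inverse (Suc m) \<longrightarrow>
        \<bar>mderiv \<alpha> f x - mderiv \<alpha> f y\<bar> \<le> s a / 4))"
  have "\<exists>t. good t f" if f: "f \<in> C0_space k \<omega>" for f
  proof -
    obtain \<delta> where \<delta>: "\<delta> > 0" "\<forall>\<alpha> x y. mi_order \<alpha> = k \<longrightarrow> x \<noteq> y \<longrightarrow> norm (x - y) < \<delta> \<longrightarrow>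
        \<bar>mderiv \<alpha> f x - mderiv \<alpha> f y\<bar> \<le> \<eta> / 2 * \<omega> (norm (x - y))"
      using C0_uniform_oscillation[OF w f half_gt_zero[OF \<eta>(1)]] by meson
    obtain a where a: "inverse (Suc a) < \<delta>" using reals_Archimedean[OF \<delta>(1)] by blast
    have s4: "0 < s a / 4" using s(1)[of a] by simp
    obtain r where r: "\<forall>\<alpha> x. mi_order \<alpha> \<le> k \<longrightarrow> r \<le> norm x \<longrightarrow> \<bar>mderiv \<alpha> f x\<bar> \<le> s a / 4"
      using C0_uniform_vanishing[OF f s4] by meson
    obtain R :: nat where R: "r \<le> R" using real_arch_simple by blast
    obtain d where d: "d > 0" "\<forall>\<alpha> x y. mi_order \<alpha> \<le> k \<longrightarrow> norm (x - y) < d \<longrightarrow>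
        \<bar>mderiv \<alpha> f x - mderiv \<alpha> f y\<bar> \<le> s a / 4"
      using C0_uniform_continuity[OF f s4] by meson
    obtain m where m: "inverse (Suc m) < d" using reals_Archimedean[OF d(1)] by blast
    have "good (a, R, m) f"
      unfolding good_def prod.case
    proof (intro conjI allI impI)
      fix \<alpha> :: "'n \<Rightarrow> nat" and x y :: "real^'n"
      show "\<bar>mderiv \<alpha> f x - mderiv \<alpha> f y\<bar> \<le> \<eta> / 2 * \<omega> (norm (x - y))"
        if "mi_order \<alpha> = k" "x \<noteq> y" "norm (x - y) < inverse (Suc a)"
        using \<delta>(2) that less_trans[OF that(3) a] by simp
      show "\<bar>mderiv \<alpha> f x\<bar> \<le> s a / 4" if "mi_order \<alpha> \<le> k" "real R \<le> norm x"
        using r that(1) order_trans[OF R that(2)] by simp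
      show "\<bar>mderiv \<alpha> f x - mderiv \<alpha> f y\<bar> \<le> s a / 4"
        if "mi_order \<alpha> \<le> k" "norm (x - y) < inverse (Suc m)"
        using d(2) that(1) less_trans[OF that(2) m] by simp
    qed
    then show ?thesis by blast
  qed
  then obtain t where t: "\<And>f. f \<in> C0_space k \<omega> \<Longrightarrow> good (t f) f" by metis
  have "\<exists>ps. cball (0::real^'n) (real R) \<subseteq> (\<Union>p\<in>set ps. ball p (inverse (Suc m)))" for R m :: nat
  proof -
    have "0 < inverse (real (Suc m))" by simp
    then obtain T where T: "finite T" "cball (0::real^'n) (real R) \<subseteq> (\<Union>p\<in>T. ball p (inverse (Suc m)))"
      using compact_cball[of "0::real^'n" "real R"] unfolding compact_eq_totally_bounded by blast
    obtain ps where "set ps = T" using finite_list[OF T(1)] by blast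
    with T(2) have "cball (0::real^'n) (real R) \<subseteq> (\<Union>p\<in>set ps. ball p (inverse (Suc m)))" by simp
    then show ?thesis by (rule exI)
  qed
  then obtain net :: "nat \<Rightarrow> nat \<Rightarrow> (real^'n) list" where
      net: "\<And>R m. cball 0 (real R) \<subseteq> (\<Union>p\<in>set (net R m). ball p (inverse (Suc m)))" by metis
  obtain as :: "('n \<Rightarrow> nat) list" where as: "set as = {\<alpha>. mi_order \<alpha> \<le> k}"
    using finite_list[OF finite_mi_order_le] by blast
  define data where "data = (\<lambda>(a, R, m) f.
    map (\<lambda>(\<alpha>, p). \<lfloor>mderiv \<alpha> f p / (s a / 4)\<rfloor>) (List.product as (net R m)))"
  have close: "Cb_norm k \<omega> (\<lambda>x. f x - g x) < e"
    if f: "f \<in> C0_space k \<omega>" and g: "g \<in> C0_space k \<omega>" and tt: "t f = t g" "data (t f) f = data (t g) g"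
    for f g
  proof -
    obtain a R m where arm: "t f = (a, R, m)" by (rule prod_cases3)
    have good: "good (a, R, m) f" "good (a, R, m) g" using t[OF f] t[OF g] arm tt(1) by simp_all
    have C: "C_k k f" "C_k k g" by (rule C0_space_C_k[OF f], rule C0_space_C_k[OF g])
    have osc: "\<bar>mderiv \<alpha> h x - mderiv \<alpha> h y\<bar> \<le> \<eta> / 2 * \<omega> (norm (x - y))"
      if "good (a, R, m) h" "mi_order \<alpha> = k" "x \<noteq> y" "norm (x - y) < inverse (Suc a)" for h \<alpha> x y
      using that unfolding good_def by simp
    have vanish: "\<bar>mderiv \<alpha> h x\<bar> \<le> s a / 4"
      if "good (a, R, m) h" "mi_order \<alpha> \<le> k" "real R \<le> norm x" for h \<alpha> x
      using that unfolding good_def by simp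
    have unif: "\<bar>mderiv \<alpha> h x - mderiv \<alpha> h y\<bar> \<le> s a / 4"
      if "good (a, R, m) h" "mi_order \<alpha> \<le> k" "norm (x - y) < inverse (Suc m)" for h \<alpha> x y
      using that unfolding good_def by simp
    have grid: "\<bar>mderiv \<alpha> f p - mderiv \<alpha> g p\<bar> \<le> s a / 4"
      if "mi_order \<alpha> \<le> k" "p \<in> set (net R m)" for \<alpha> p
    proof -
      have "\<lfloor>mderiv \<alpha> f p / (s a / 4)\<rfloor> = \<lfloor>mderiv \<alpha> g p / (s a / 4)\<rfloor>"
      proof -
        have "data (a, R, m) f = data (a, R, m) g" using tt arm by simp
        moreover have "(\<alpha>, p) \<in> set (List.product as (net R m))" using that as by simp
        ultimately show ?thesis unfolding data_def prod.case map_eq_conv by fast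
      qed
      then have "\<bar>mderiv \<alpha> f p / (s a / 4) - mderiv \<alpha> g p / (s a / 4)\<bar> \<le> 1" by linarith
      then have "\<bar>(mderiv \<alpha> f p - mderiv \<alpha> g p) / (s a / 4)\<bar> \<le> 1" by (simp only: diff_divide_distrib)
      moreover have q: "0 < s a / 4" using s(1)[of a] by simp
      ultimately show ?thesis
        by (simp only: abs_divide[of _ "s a / 4"] abs_of_pos[OF q] pos_divide_le_eq[OF q] mult_1)
    qed
    have "Cb_enorm k \<omega> (\<lambda>x. f x - g x) \<le> ennreal \<eta>"
    proof (rule Cb_enorm_le_local[OF w C_k_diff[OF C] _ less_imp_le[OF \<eta>(1)] _ s(2,3)])
      show "0 < inverse (real (Suc a))" by simp
      fix \<alpha> :: "'n \<Rightarrow> nat" and x :: "real^'n" assume \<alpha>: "mi_order \<alpha> \<le> k"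
      show "\<bar>mderiv \<alpha> (\<lambda>x. f x - g x) x\<bar> \<le> s a"
      proof (cases "real R \<le> norm x")
        case True
        then show ?thesis
          using vanish[OF good(1) \<alpha> True] vanish[OF good(2) \<alpha> True] s(1)[of a]
          unfolding mderiv_diff[OF C \<alpha>] by linarith
      next
        case False
        then have "x \<in> cball 0 (real R)" by simp
        then obtain p where p: "p \<in> set (net R m)" "norm (x - p) < inverse (Suc m)"
          using net[of R m] by (auto simp: dist_norm norm_minus_commute)
        show ?thesis
          using unif[OF good(1) \<alpha> p(2)] unif[OF good(2) \<alpha> p(2)] grid[OF \<alpha> p(1)] s(1)[of a]
          unfolding mderiv_diff[OF C \<alpha>] by linarith
      qed
    next
      fix \<alpha> :: "'n \<Rightarrow> nat" and x y :: "real^'n"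
      assume \<alpha>: "mi_order \<alpha> = k" and xy: "x \<noteq> y" "norm (x - y) < inverse (real (Suc a))"
      show "\<bar>mderiv \<alpha> (\<lambda>x. f x - g x) x - mderiv \<alpha> (\<lambda>x. f x - g x) y\<bar> \<le> \<eta> * \<omega> (norm (x - y))"
        using osc[OF good(1) \<alpha> xy] osc[OF good(2) \<alpha> xy]
        unfolding mderiv_diff[OF C eq_refl[OF \<alpha>]] by linarith
    qed
    then have "Cb_norm k \<omega> (\<lambda>x. f x - g x) \<le> \<eta>"
      unfolding Cb_norm_def using \<eta>(1) by (intro enn2real_leI) auto
    with \<eta>(2) show ?thesis by simp
  qed
  show ?thesis
  proof (intro exI[of _ "\<lambda>f. (t f, data (t f) f)"] ballI impI)
    fix f g :: "real^'n \<Rightarrow> real"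
    assume "f \<in> C0_space k \<omega>" "g \<in> C0_space k \<omega>" "(t f, data (t f) f) = (t g, data (t g) g)"
    then show "Cb_norm k \<omega> (\<lambda>x. f x - g x) < e" using close by blast
  qed
qed

lemma separable_C0_topology:
  assumes "modulus_of_continuity \<omega>"
  shows "separable_space (C0_topology k \<omega> :: (real^'n::finite \<Rightarrow> real) topology)"
  unfolding C0_topology_def
  by (rule Metric_space.separable_space_of_codes[OF Metric_space_C0[OF assms] C0_space_codes[OF assms]])

text \<open>Restriction to \<open>S\<close> does not increase norms and maps onto the trace space.\<close>

lemma separable_C0_trace_topology:
  fixes S :: "(real^'n::finite) set"
  assumes w: "modulus_of_continuity \<omega>"
  shows "separable_space (C0_trace_topology k \<omega> S)"
proof (rule separable_space_continuous_map_image[OF separable_C0_topology[OF w]])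
  note M = Metric_space_C0[OF w, of k] and M' = Metric_space_C0_trace[OF w, of k S]
  have le: "trace_norm k \<omega> S (\<lambda>x. restrict F S x - restrict G S x) \<le> Cb_norm k \<omega> (\<lambda>x. F x - G x)"
    if "F \<in> C0_space k \<omega>" "G \<in> C0_space k \<omega>" for F G :: "real^'n \<Rightarrow> real"
    unfolding trace_norm_def Cb_norm_def
  proof (rule enn2real_mono)
    show "(INF H\<in>{H \<in> C0_space k \<omega>. \<forall>x\<in>S. H x = restrict F S x - restrict G S x}. Cb_enorm k \<omega> H)
        \<le> Cb_enorm k \<omega> (\<lambda>x. F x - G x)"
      by (rule INF_lower) (simp add: C0_space_diff[OF w that])
    show "Cb_enorm k \<omega> (\<lambda>x. F x - G x) < top" by (rule C0_space_finite[OF C0_space_diff[OF w that]])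
  qed
  show "continuous_map (C0_topology k \<omega>) (C0_trace_topology k \<omega> S) (\<lambda>F. restrict F S)"
    unfolding C0_topology_def C0_trace_topology_def Metric_space.metric_continuous_map[OF M M']
  proof (intro conjI ballI allI impI)
    show "(\<lambda>F. restrict F S) ` C0_space k \<omega> \<subseteq> C0_trace k \<omega> S" by (simp add: C0_trace_def)
    fix F :: "real^'n \<Rightarrow> real" and \<epsilon> :: real assume "F \<in> C0_space k \<omega>" "0 < \<epsilon>"
    then show "\<exists>\<delta>>0. \<forall>G. G \<in> C0_space k \<omega> \<and> Cb_norm k \<omega> (\<lambda>x. F x - G x) < \<delta> \<longrightarrow>
        trace_norm k \<omega> S (\<lambda>x. restrict F S x - restrict G S x) < \<epsilon>"
      using le by (meson le_less_trans)
  qed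
  show "(\<lambda>F. restrict F S) ` topspace (C0_topology k \<omega>) = topspace (C0_trace_topology k \<omega> S)"
    unfolding C0_topology_def C0_trace_topology_def Metric_space.topspace_mtopology[OF M]
      Metric_space.topspace_mtopology[OF M'] by (simp add: C0_trace_def)
qed

theorem corollary1p13:
  fixes k :: nat and \<omega> :: "real \<Rightarrow> real"
  assumes "modulus_of_continuity \<omega>"
    and "((\<lambda>t. t / \<omega> t) \<longlongrightarrow> 0) (at_right 0)"
  shows "(Cc_infty :: (real^'n::finite \<Rightarrow> real) set) \<subseteq> C0_space k \<omega> \<and>
         C0_topology k \<omega> closure_of (Cc_infty :: (real^'n \<Rightarrow> real) set) = C0_space k \<omega> \<and>
         (\<forall>S :: (real^'n) set. closed S \<longrightarrow> separable_space (C0_trace_topology k \<omega> S))"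
proof (intro conjI allI impI)
  show sub: "(Cc_infty :: (real^'n \<Rightarrow> real) set) \<subseteq> C0_space k \<omega>"
    by (rule Cc_infty_subset_C0[OF assms])
  note M = Metric_space_C0[OF assms(1), of k]
  show "C0_topology k \<omega> closure_of (Cc_infty :: (real^'n \<Rightarrow> real) set) = C0_space k \<omega>"
    unfolding C0_topology_def Metric_space.metric_closure_of[OF M]
  proof (intro equalityI subsetI CollectI conjI allI impI)
    fix f :: "real^'n \<Rightarrow> real" and r :: real assume f: "f \<in> C0_space k \<omega>" and r: "0 < r"
    obtain h where "h \<in> Cc_infty" "Cb_norm k \<omega> (\<lambda>x. f x - h x) < r"
      by (rule Cc_infty_approx[OF assms(1) f r])
    then show "\<exists>h\<in>Cc_infty. h \<in> Metric_space.mball (C0_space k \<omega>) (\<lambda>f g. Cb_norm k \<omega> (\<lambda>x. f x - g x)) f r"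
      using f sub by (intro bexI[of _ h]) (auto simp: Metric_space.in_mball[OF M])
  qed auto
  show "separable_space (C0_trace_topology k \<omega> S)" for S :: "(real^'n) set"
    by (rule separable_C0_trace_topology[OF assms(1)])
qed

end
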